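(* Let $\pi,\sigma$ be permutations of $\mathbb{N}_0$. Suppose $\pi$ differs from $\sigma$ by $\hat f$, that is, $\hat f(u)=|\pi(u)-\sigma(u)|$ for $u\in\mathbb{N}_0$, and let $\hat f_n^*=\max_{u\in[2^n]}\hat f(u)$. If $\hat f$ and $\#\hat A_n^\pi$ satisfy $$\liminf_{n\to\infty}8^{-n}\,\#\hat A_n^\pi\,\hat f_n^*=0,$$ then, for all $p\in(1,\infty)$ with $p\ne2$, the systems $(e_{\sigma(k)})_{k\ge0}$ and $(w_k)_{k\ge0}$ are not equivalent in $L_p$. This is in particular the case if $\pi$ is dyadically linear and $\hat f$ satisfies $\hat f_n^*=o\left(\frac{4^n}{3^n}\right)$ as $n\to\infty$.
   Context: $\mathbb{N}_0=\{0,1,2,\ldots\}$ and $[m]=\{0,1,\ldots,m-1\}$; $\#A$ is the cardinality of $A$. For $m,n\in\mathbb{N}_0$ with binary expansions $m=\sum_{i\ge0} m_i2^i$ and $n=\sum_{i\ge0} n_i2^i$, $m_i,n_i\in\{0,1\}$, the dyadic sum is $m\oplus n=\sum_{i\ge 0}|m_i-n_i|2^i$ (bitwise XOR). On $[0,1]$, $e_n(t)=\exp(2\pi i n t)$; $r_0,r_1,\ldots$ are the Rademacher functions ($r_i(t)=\operatorname{sign}\sin(2^{i+1}\pi t)$), and $w_n=\prod_{i\ge 0} r_i^{n_i}$ is the $n$-th Walsh function. Two systems $(a_k)_{k\ge0}$, $(b_k)_{k\ge0}$ in $L_p[0,1]$ are equivalent in $L_p$ if there is $c>0$ such that $\frac1c\|\sum_k\xi_k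 a_k\|_p\le\|\sum_k\xi_k b_k\|_p\le c\|\sum_k\xi_k a_k\|_p$ for all complex sequences $(\xi_k)_{k\ge0}$ with only finitely many nonzero terms; $\|\cdot\|_p$ is the norm of $L_p[0,1]$. A permutation $\pi$ of $\mathbb{N}_0$ is dyadically linear if $\pi(m\oplus n)=\pi(m)\oplus\pi(n)$ for all $m,n\in\mathbb{N}_0$. For a permutation $\pi$ of $\mathbb{N}_0$, $\hat A_n^\pi=\{(x,y,z)\in[2^n]^3 : \pi(x)+\pi(y)-\pi(z)=\pi(x\oplus y\oplus z)\}$. *)

theory Defs
  imports "HOL-Analysis.Analysis" "HOL-Library.Landau_Symbols"
begin

unbundle bit_operations_syntax

definition trig :: "nat \<Rightarrow> real \<Rightarrow> complex" where
  "trig n t = exp (2 * of_real pi * \<i> * of_nat n * of_real t)"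

definition rademacher :: "nat \<Rightarrow> real \<Rightarrow> real" where
  "rademacher i t = sgn (sin (2 ^ (i + 1) * pi * t))"

(* The factors r_i^(n_i) with n_i = 0 equal 1, so only the finitely many
   positions i of a nonzero binary digit of n contribute. *)
definition walsh :: "nat \<Rightarrow> real \<Rightarrow> real" where
  "walsh n t = (\<Prod>i | bit n i. rademacher i t)"

definition Lp_norm :: "real \<Rightarrow> (real \<Rightarrow> complex) \<Rightarrow> real" where
  "Lp_norm p f = (LINT t:{0..1}|lborel. norm (f t) powr p) powr (1 / p)"

(* Lp_norm agrees with the norm of L_p[0,1] only on functions belonging to that
   space (the Bochner integral of a non-integrable function is 0), so this is
   meant for systems a, b in L_p. *)
definition equivalent_Lp ::
    "real \<Rightarrow> (nat \<Rightarrow> real \<Rightarrow> complex) \<Rightarrow> (nat \<Rightarrow> real \<Rightarrow> complex) \<Rightarrow> bool" where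
  "equivalent_Lp p a b \<longleftrightarrow>
     (\<exists>c>0. \<forall>\<xi> :: nat \<Rightarrow> complex. finite {k. \<xi> k \<noteq> 0} \<longrightarrow>
        1 / c * Lp_norm p (\<lambda>t. \<Sum>k | \<xi> k \<noteq> 0. \<xi> k * a k t)
          \<le> Lp_norm p (\<lambda>t. \<Sum>k | \<xi> k \<noteq> 0. \<xi> k * b k t) \<and>
        Lp_norm p (\<lambda>t. \<Sum>k | \<xi> k \<noteq> 0. \<xi> k * b k t)
          \<le> c * Lp_norm p (\<lambda>t. \<Sum>k | \<xi> k \<noteq> 0. \<xi> k * a k t))"

(* The dyadic sum of natural numbers is bitwise XOR. *)
definition dyadically_linear :: "(nat \<Rightarrow> nat) \<Rightarrow> bool" where
  "dyadically_linear \<pi> \<longleftrightarrow> (\<forall>m n. \<pi> (m XOR n) = \<pi> m XOR \<pi> n)"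

(* The defining equation is read in the integers, as the left-hand side may be
   negative. *)
definition A_hat :: "(nat \<Rightarrow> nat) \<Rightarrow> nat \<Rightarrow> (nat \<times> nat \<times> nat) set" where
  "A_hat \<pi> n =
     {(x, y, z). x < 2 ^ n \<and> y < 2 ^ n \<and> z < 2 ^ n \<and>
        int (\<pi> x) + int (\<pi> y) - int (\<pi> z) = int (\<pi> (x XOR y XOR z))}"

definition block_max :: "(nat \<Rightarrow> nat) \<Rightarrow> nat \<Rightarrow> nat" where
  "block_max f n = Max (f ` {..<2 ^ n})"

end

theory Submission
  imports Defs "HOL-Library.Function_Algebras" "HOL-Library.Z2"
begin

text \<open>
  Why the systems are not equivalent: a Walsh polynomial with peaked values forces additive structure
  on the graph of \<open>\<sigma>\<close>, and the graph of an injective map from a group of exponent two into the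
  integers has no such structure.

  Let \<open>N = 2 ^ n\<close>. For every sign pattern \<open>\<chi>\<close> that is a character of the group \<open>([N], \<oplus>)\<close>, the Walsh
  polynomial with coefficients \<open>\<chi>\<close> is a product of factors \<open>1 \<plusminus> r\<^sub>i\<close>. It takes the values \<open>0\<close> and \<open>N\<close>
  only and has mean \<open>1\<close>, so the \<open>p\<close>-th power of its norm is \<open>N\<close> to the power \<open>p - 1\<close>. If the two systems
  were equivalent, the trigonometric polynomial \<open>F\<close> with the same coefficients would have a \<open>p\<close>-th moment
  of this order, while always \<open>|F| \<le> N\<close> and \<open>\<integral> |F|\<^sup>2 = N\<close>. For \<open>p \<noteq> 2\<close> this leaves no room: a fixed
  share of the second moment must come from points at which \<open>|F|\<close> is comparable to \<open>N\<close>, and so the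
  fourth moment of \<open>F\<close> is at least a constant times \<open>8 ^ n\<close> (\<open>equivalent_imp_fourth_moment\<close>).

  The mean of the fourth moments over all characters \<open>\<chi>\<close> counts the additive quadruples
  \<open>a - b = c - d\<close> in the graph \<open>{(k, \<sigma> k) | k < N}\<close>, which lives in the product of a group of exponent
  two with the integers. By the Balog--Szemeredi--Gowers theorem the graph has a subset \<open>B\<close>, of size at
  least a constant times \<open>N\<close>, with at most a constant times \<open>|B|\<close> differences, and then also few
  elements of the form \<open>z + 2 (x - y)\<close> (\<open>small_doubling_dilate\<close>). Doubling annihilates the first
  coordinate. Therefore \<open>z + 2 (x - y)\<close> with \<open>y\<close> fixed determines the first coordinate of \<open>z\<close>, hence \<open>z\<close>,
  hence the second coordinate of \<open>x\<close>, hence \<open>x\<close>: there are about \<open>|B|\<^sup>2\<close> such elements. This bounds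
  \<open>|B|\<close> and so \<open>N\<close> independently of \<open>n\<close> (\<open>card_le_of_energy_torsion_graph\<close>), which is absurd.

  For a dyadically linear \<open>\<pi>\<close> the equation that defines the set \<open>A_hat \<pi> n\<close> says that \<open>\<pi> x \<oplus> \<pi> z\<close> and
  \<open>\<pi> y \<oplus> \<pi> z\<close> have no common binary digit. The vectors of an \<open>n\<close>-dimensional space over the field
  with two elements form at most \<open>3 ^ n\<close> pairs without a common digit, so the set has at most
  \<open>2 ^ n * 3 ^ n\<close> elements, and \<open>6 ^ n / 8 ^ n = (3 / 4) ^ n\<close> is what the growth condition on the
  difference compensates.
\<close>

section \<open>Sets with large additive energy in abelian groups\<close>

lemma card_mult_le_of_fibers:
  fixes k :: real
  assumes "finite T" "finite E" and fib: "\<And>e. e \<in> E \<Longrightarrow> k \<le> card {t \<in> T. f t = e}"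
  shows "card E * k \<le> card T"
proof -
  have "card E * k = (\<Sum>e\<in>E. k)" by simp
  also have "\<dots> \<le> (\<Sum>e\<in>E. real (card {t \<in> T. f t = e}))"
    by (intro sum_mono fib)
  also have "\<dots> = real (card (\<Union>e\<in>E. {t \<in> T. f t = e}))"
    by (subst card_UN_disjoint) (use assms in auto)
  also have "\<dots> \<le> card T"
    using assms by (intro of_nat_mono card_mono) auto
  finally show ?thesis .
qed

definition diffs :: "'a::ab_group_add set \<Rightarrow> 'a set" where
  "diffs A = (\<lambda>(a, b). a - b) ` (A \<times> A)"

text \<open>The intersection of \<open>A\<close> with its translate by \<open>d\<close>; its cardinality is the number of ways to write
  \<open>d\<close> as a difference of two elements of \<open>A\<close>.\<close>

definition meet_shift :: "'a::ab_group_add set \<Rightarrow> 'a \<Rightarrow> 'a set" where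
  "meet_shift A d = {b \<in> A. b - d \<in> A}"

definition additive_energy :: "'a::ab_group_add set \<Rightarrow> nat" where
  "additive_energy A = card {((a, b), (c, d)). a \<in> A \<and> b \<in> A \<and> c \<in> A \<and> d \<in> A \<and> a - b = c - d}"

lemma finite_diffs [simp]: "finite A \<Longrightarrow> finite (diffs A)"
  by (simp add: diffs_def)

lemma finite_meet_shift [simp]: "finite A \<Longrightarrow> finite (meet_shift A d)"
  by (simp add: meet_shift_def)

lemma diff_in_diffs [intro]: "a \<in> A \<Longrightarrow> b \<in> A \<Longrightarrow> a - b \<in> diffs A"
  by (auto simp: diffs_def)

lemma card_pairs_diff: "card {(a, b). a \<in> A \<and> b \<in> A \<and> a - b = d} = card (meet_shift A d)"
  by (rule bij_betw_same_card[of fst], rule bij_betw_byWitness[where f' = "\<lambda>a. (a, a - d)"])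
     (auto simp: meet_shift_def)

lemma card_pairs_diff_in:
  assumes "finite A" "finite D"
  shows "card {p \<in> A \<times> A. fst p - snd p \<in> D} = (\<Sum>d\<in>D. card (meet_shift A d))"
proof -
  have "{p \<in> A \<times> A. fst p - snd p \<in> D} = (\<Union>d\<in>D. {(a, b). a \<in> A \<and> b \<in> A \<and> a - b = d})"
    by auto
  also have "card \<dots> = (\<Sum>d\<in>D. card {(a, b). a \<in> A \<and> b \<in> A \<and> a - b = d})"
    by (subst card_UN_disjoint) (use assms in \<open>auto intro: finite_subset[of _ "A \<times> A"]\<close>)
  finally show ?thesis by (simp add: card_pairs_diff)
qed

lemma sum_card_meet_shift:
  assumes "finite A"
  shows "(\<Sum>d\<in>diffs A. card (meet_shift A d)) = card A ^ 2"
proof -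
  have "{p \<in> A \<times> A. fst p - snd p \<in> diffs A} = A \<times> A" by auto
  then show ?thesis using card_pairs_diff_in[of A "diffs A"] assms
    by (simp add: card_cartesian_product power2_eq_square)
qed

lemma additive_energy_eq_sum:
  assumes "finite A"
  shows "additive_energy A = (\<Sum>d\<in>diffs A. card (meet_shift A d) ^ 2)"
proof -
  let ?P = "\<lambda>d. {(a, b). a \<in> A \<and> b \<in> A \<and> a - b = d}"
  have "{((a, b), (c, d)). a \<in> A \<and> b \<in> A \<and> c \<in> A \<and> d \<in> A \<and> a - b = c - d}
      = (\<Union>d\<in>diffs A. ?P d \<times> ?P d)"
    by auto
  also have "card \<dots> = (\<Sum>d\<in>diffs A. card (?P d \<times> ?P d))"
    by (subst card_UN_disjoint) (use assms in \<open>auto intro!: finite_cartesian_product intro: finite_subset[of _ "A \<times> A"]\<close>)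
  finally show ?thesis
    by (simp add: additive_energy_def card_pairs_diff card_cartesian_product power2_eq_square)
qed

lemma card_popular_le:
  fixes k :: real
  assumes "finite A" "k > 0"
  shows "card {d \<in> diffs A. k \<le> card (meet_shift A d)} \<le> card A ^ 2 / k"
proof -
  let ?P = "{d \<in> diffs A. k \<le> card (meet_shift A d)}"
  have "card ?P * k = (\<Sum>d\<in>?P. k)" by simp
  also have "\<dots> \<le> (\<Sum>d\<in>?P. real (card (meet_shift A d)))" by (rule sum_mono) auto
  also have "\<dots> \<le> (\<Sum>d\<in>diffs A. real (card (meet_shift A d)))"
    using assms by (intro sum_mono2) auto
  also have "\<dots> = card A ^ 2"
    using sum_card_meet_shift[OF assms(1)] by (metis of_nat_power of_nat_sum)
  finally show ?thesis using assms by (simp add: field_simps)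
qed

text \<open>Two elements \<open>b\<close> and \<open>c\<close> lie in a common translate \<open>d + A\<close> once for each way to write \<open>b - c\<close> as the
  difference of \<open>b - d\<close> and \<open>c - d\<close> in \<open>A\<close>. Pairs with an unpopular difference are therefore rarely
  caught by a random \<open>meet_shift A d\<close>.\<close>

lemma sum_pairs_in_meet_shift_le:
  assumes fin: "finite A" and W: "W \<subseteq> A \<times> A"
  shows "(\<Sum>d\<in>diffs A. card (W \<inter> meet_shift A d \<times> meet_shift A d))
           \<le> (\<Sum>p\<in>W. card (meet_shift A (fst p - snd p)))"
proof -
  have finW: "finite W" using fin W by (auto intro: finite_subset)
  let ?R = "\<lambda>p d. fst p - d \<in> A \<and> snd p - d \<in> A"
  have "(\<Sum>d\<in>diffs A. card (W \<inter> meet_shift A d \<times> meet_shift A d))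
      = (\<Sum>d\<in>diffs A. card {p \<in> W. ?R p d})"
    by (intro sum.cong[OF refl] arg_cong[where f = card]) (use W in \<open>auto simp: meet_shift_def\<close>)
  also have "\<dots> = (\<Sum>p\<in>W. card {d \<in> diffs A. ?R p d})"
    using sum_multicount_gen[of "diffs A" W "\<lambda>d p. ?R p d"] fin finW by simp
  also have "\<dots> \<le> (\<Sum>p\<in>W. card (meet_shift A (fst p - snd p)))"
  proof (rule sum_mono)
    fix p assume "p \<in> W"
    then show "card {d \<in> diffs A. ?R p d} \<le> card (meet_shift A (fst p - snd p))"
      using fin W
      by (intro card_inj_on_le[where f = "\<lambda>d. fst p - d"]) (auto simp: inj_on_def meet_shift_def)
  qed
  finally show ?thesis .
qed

text \<open>Gowers' selection step. Summed over \<open>d\<close>, the numbers \<open>|meet_shift A d|\<^sup>2\<close> give the energy, whereas by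
  \<open>sum_pairs_in_meet_shift_le\<close> the unpopular pairs in these sets amount to at most \<open>\<eta> N\<^sup>3\<close>. So some
  \<open>M = meet_shift A d\<close> is large and almost all of its pairs have a popular difference: from a
  positive proportion one passes to almost everything.\<close>

lemma ex_shift_few_unpopular_pairs:
  fixes \<kappa> \<eta> \<theta> :: real
  assumes fin: "finite A" and ne: "A \<noteq> {}" and pos: "\<kappa> > 0" "\<theta> > 0" "\<eta> > 0"
    and en: "\<kappa> * card A ^ 3 \<le> additive_energy A" and \<eta>: "\<eta> \<le> \<theta> * \<kappa> / 4"
  obtains M where "M \<subseteq> A" "\<kappa> / 2 * card A < card M"
    "card {(b, c). b \<in> M \<and> c \<in> M \<and> card (meet_shift A (b - c)) < \<eta> * card A} < \<theta> * card M ^ 2"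
proof -
  let ?N = "real (card A)"
  let ?m = "\<lambda>d. real (card (meet_shift A d))"
  let ?W = "{(b, c). b \<in> A \<and> c \<in> A \<and> ?m (b - c) < \<eta> * ?N}"
  let ?w = "\<lambda>d. real (card (?W \<inter> meet_shift A d \<times> meet_shift A d))"
  have N: "?N > 0" using fin ne by (simp add: card_gt_0_iff)
  have W: "?W \<subseteq> A \<times> A" by auto
  have cW: "real (card ?W) \<le> ?N ^ 2"
    using card_mono[OF _ W] fin by (simp add: card_cartesian_product power2_eq_square flip: of_nat_mult)
  have "(\<Sum>d\<in>diffs A. ?w d) \<le> (\<Sum>p\<in>?W. ?m (fst p - snd p))"
    using of_nat_mono[OF sum_pairs_in_meet_shift_le[OF fin W], where ?'a = real] by (simp only: of_nat_sum)
  also have "\<dots> \<le> (\<Sum>p\<in>?W. \<eta> * ?N)" by (rule sum_mono) auto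
  also have "\<dots> \<le> ?N ^ 2 * (\<eta> * ?N)"
    using cW pos by (simp only: sum_constant) (intro mult_right_mono, auto)
  also have "\<dots> = \<eta> * ?N ^ 3" by (simp add: power2_eq_square power3_eq_cube)
  also have "\<dots> \<le> \<theta> * \<kappa> / 4 * ?N ^ 3" using \<eta> by (intro mult_right_mono) auto
  finally have bad: "(\<Sum>d\<in>diffs A. ?w d) \<le> \<theta> * \<kappa> / 4 * ?N ^ 3" .
  have sq: "(\<Sum>d\<in>diffs A. ?m d ^ 2) \<ge> \<kappa> * ?N ^ 3"
    using en additive_energy_eq_sum[OF fin] by simp
  have lin: "(\<Sum>d\<in>diffs A. ?m d) = ?N ^ 2"
    using sum_card_meet_shift[OF fin] by (metis of_nat_power of_nat_sum)
  \<comment> \<open>The linear term on the left forces the chosen set to be large; summed over \<open>d\<close> it uses up only half of the assumed energy.\<close>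
  have "\<exists>d\<in>diffs A. ?w d + \<theta> * \<kappa> / 2 * ?N * ?m d < \<theta> * ?m d ^ 2"
  proof (rule ccontr)
    assume "\<not> ?thesis"
    then have "(\<Sum>d\<in>diffs A. \<theta> * ?m d ^ 2) \<le> (\<Sum>d\<in>diffs A. ?w d + \<theta> * \<kappa> / 2 * ?N * ?m d)"
      by (intro sum_mono) (auto simp: not_less)
    also have "\<dots> = (\<Sum>d\<in>diffs A. ?w d) + \<theta> * \<kappa> / 2 * ?N * ?N ^ 2"
      by (simp only: sum.distrib flip: lin sum_distrib_left)
    also have "\<dots> \<le> \<theta> * \<kappa> * ?N ^ 3 * (3 / 4)"
      using bad by (simp add: power2_eq_square power3_eq_cube mult_ac)
    finally have "(\<Sum>d\<in>diffs A. \<theta> * ?m d ^ 2) \<le> \<theta> * (\<kappa> * ?N ^ 3) * (3 / 4)"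
      by (simp only: mult_ac)
    moreover have "\<theta> * (\<kappa> * ?N ^ 3) \<le> (\<Sum>d\<in>diffs A. \<theta> * ?m d ^ 2)"
      using mult_left_mono[OF sq, of \<theta>] pos by (simp only: sum_distrib_left less_imp_le)
    moreover have "\<theta> * (\<kappa> * ?N ^ 3) > 0" using pos N by simp
    ultimately show False by linarith
  qed
  then obtain d where d: "?w d + \<theta> * \<kappa> / 2 * ?N * ?m d < \<theta> * ?m d ^ 2" by auto
  then have "\<theta> * \<kappa> / 2 * ?N * ?m d < \<theta> * ?m d ^ 2"
    by (smt (verit) of_nat_0_le_iff)
  then have "(\<theta> * ?m d) * (\<kappa> / 2 * ?N) < (\<theta> * ?m d) * ?m d"
    by (simp add: power2_eq_square mult_ac)
  then have "\<kappa> / 2 * ?N < ?m d"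
    using pos by (simp add: mult_less_cancel_left)
  moreover have "?w d < \<theta> * ?m d ^ 2"
  proof -
    have "0 \<le> \<theta> * \<kappa> / 2 * ?N * ?m d" using pos by simp
    with d show ?thesis by linarith
  qed
  moreover have "?W \<inter> meet_shift A d \<times> meet_shift A d
    = {(b, c). b \<in> meet_shift A d \<and> c \<in> meet_shift A d \<and> card (meet_shift A (b - c)) < \<eta> * card A}"
    by (auto simp: meet_shift_def)
  ultimately show thesis by (intro that[of "meet_shift A d"]) (auto simp: meet_shift_def)
qed

text \<open>In the set \<open>M\<close> of the selection step keep the elements \<open>b\<close> that form unpopular differences with at
  most a quarter of \<open>M\<close>. Any two of them share at least half of \<open>M\<close> as good partners \<open>c\<close>, and each such
  \<open>c\<close> writes \<open>b - b' = (b - c) - (b' - c)\<close> by two popular differences. There are few popular differences,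
  hence few pairs of them, hence few values \<open>b - b'\<close>.\<close>

theorem Balog_Szemeredi_Gowers:
  fixes \<kappa> :: real
  assumes fin: "finite A" and ne: "A \<noteq> {}" and pos: "\<kappa> > 0"
    and en: "\<kappa> * card A ^ 3 \<le> additive_energy A"
  obtains B where "B \<subseteq> A" "\<kappa> / 4 * card A < card B" "card (diffs B) \<le> 16384 / \<kappa> ^ 4 * card B"
proof -
  let ?N = "real (card A)"
  define \<eta> where "\<eta> = \<kappa> / 32"
  let ?unpop = "\<lambda>b c. card (meet_shift A (b - c)) < \<eta> * ?N"
  have N: "?N > 0" using fin ne by (simp add: card_gt_0_iff)
  obtain M where M: "M \<subseteq> A" and cM: "\<kappa> / 2 * ?N < card M"
    and few: "card {(b, c). b \<in> M \<and> c \<in> M \<and> ?unpop b c} < (1 / 8) * real (card M) ^ 2"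
    using ex_shift_few_unpopular_pairs[OF fin ne pos _ _ en, of "1/8" \<eta>] pos by (auto simp: \<eta>_def)
  let ?m = "real (card M)"
  have m: "?m > 0" using cM N pos by (smt (verit) mult_pos_pos divide_pos_pos)
  have finM: "finite M" using M fin finite_subset by auto
  define B where "B = {b \<in> M. card {c \<in> M. ?unpop b c} \<le> ?m / 4}"
  have BM: "B \<subseteq> M" by (auto simp: B_def)
  have finB: "finite B" using BM finM finite_subset by auto
  \<comment> \<open>Markov: an element outside \<open>B\<close> accounts for more than \<open>m / 4\<close> of the fewer than \<open>m\<^sup>2 / 8\<close> unpopular pairs.\<close>
  have "card (M - B) * (?m / 4) \<le> card {(b, c). b \<in> M \<and> c \<in> M \<and> ?unpop b c}"
  proof (rule card_mult_le_of_fibers[where f = fst])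
    show "finite {(b, c). b \<in> M \<and> c \<in> M \<and> ?unpop b c}"
      by (rule finite_subset[of _ "M \<times> M"]) (use finM in auto)
    fix b assume b: "b \<in> M - B"
    have "card {c \<in> M. ?unpop b c} = card {t \<in> {(b, c). b \<in> M \<and> c \<in> M \<and> ?unpop b c}. fst t = b}"
      by (rule bij_betw_same_card[of "Pair b"], rule bij_betw_byWitness[where f' = snd]) (use b in auto)
    then show "?m / 4 \<le> card {t \<in> {(b, c). b \<in> M \<and> c \<in> M \<and> ?unpop b c}. fst t = b}"
      using b by (auto simp: B_def)
  qed (use finM in auto)
  with few have "real (card (M - B)) * (?m / 4) < ?m / 2 * (?m / 4)"
    by (simp add: power2_eq_square mult_ac)
  then have "real (card (M - B)) < ?m / 2" using m by (simp add: mult_less_cancel_right)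
  then have cB: "?m / 2 < card B"
    using card_Diff_subset[OF finB BM] card_mono[OF finM BM] by simp
  let ?P = "{d \<in> diffs A. \<eta> * ?N \<le> card (meet_shift A d)}"
  have cP: "card ?P \<le> ?N / \<eta>"
    using card_popular_le[OF fin, of "\<eta> * ?N"] N pos by (simp add: \<eta>_def power2_eq_square)
  have "card (diffs B) * (?m / 2) \<le> card (?P \<times> ?P)"
  proof (rule card_mult_le_of_fibers[where f = "\<lambda>(u, v). u - v"])
    fix e assume "e \<in> diffs B"
    then obtain b b' where b: "b \<in> B" "b' \<in> B" and e: "e = b - b'" by (auto simp: diffs_def)
    let ?G = "M - {c \<in> M. ?unpop b c} - {c \<in> M. ?unpop b' c}"
    have "card M \<le> card (?G \<union> {c \<in> M. ?unpop b c} \<union> {c \<in> M. ?unpop b' c})"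
      using finM by (intro card_mono) auto
    also have "\<dots> \<le> card ?G + card {c \<in> M. ?unpop b c} + card {c \<in> M. ?unpop b' c}"
      by (rule order_trans[OF card_Un_le add_right_mono[OF card_Un_le]])
    finally have "card M \<le> \<dots>" .
    then have "?m / 2 \<le> card ?G"
      using b by (auto simp: B_def)
    also have "card ?G \<le> card {t \<in> ?P \<times> ?P. (case t of (u, v) \<Rightarrow> u - v) = e}"
    proof (rule card_inj_on_le[where f = "\<lambda>c. (b - c, b' - c)"])
      show "(\<lambda>c. (b - c, b' - c)) ` ?G \<subseteq> {t \<in> ?P \<times> ?P. (case t of (u, v) \<Rightarrow> u - v) = e}"
        using b BM M by (auto simp: e not_less)
    qed (use fin in \<open>auto simp: inj_on_def\<close>)
    finally show "?m / 2 \<le> card {t \<in> ?P \<times> ?P. (case t of (u, v) \<Rightarrow> u - v) = e}" by simp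
  qed (use fin finB in auto)
  also have "\<dots> = real (card ?P) ^ 2" by (simp add: card_cartesian_product power2_eq_square)
  also have "\<dots> \<le> (?N / \<eta>) ^ 2" using cP by (intro power_mono) auto
  also have "\<dots> = 1024 / \<kappa> ^ 2 * ?N ^ 2" by (simp add: \<eta>_def power_divide field_simps)
  also have "\<dots> \<le> 1024 / \<kappa> ^ 2 * (2 / \<kappa> * ?m) ^ 2"
    using cM pos by (intro mult_left_mono power_mono) (auto simp: field_simps)
  also have "\<dots> = 8192 / \<kappa> ^ 4 * ?m * (?m / 2)"
    by (simp add: power2_eq_square power4_eq_xxxx)
  finally have "card (diffs B) \<le> 8192 / \<kappa> ^ 4 * ?m"
    by (rule mult_right_le_imp_le) (use m in simp)
  also have "\<dots> \<le> 8192 / \<kappa> ^ 4 * (2 * card B)" using cB pos by (intro mult_left_mono) auto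
  finally have "card (diffs B) \<le> 16384 / \<kappa> ^ 4 * card B" by simp
  moreover have "\<kappa> / 4 * ?N < card B" using cM cB by simp
  ultimately show thesis using BM M by (intro that[of B]) auto
qed

text \<open>If \<open>s = b\<^sub>1 - c\<^sub>1 = b\<^sub>2 - c\<^sub>2\<close> then \<open>z + 2 s = (z - c\<^sub>1) + (b\<^sub>1 - c\<^sub>2) + b\<^sub>2\<close>, and the three summands
  recover \<open>b\<^sub>1\<close> and \<open>b\<^sub>2\<close> when \<open>z\<close> and \<open>s\<close> are known. So a popular \<open>s\<close> makes \<open>z + 2 s\<close> a sum of two
  differences and an element of \<open>B\<close> in many ways, and there are only \<open>|B - B|\<^sup>2 |B|\<close> such sums. At
  least half of all pairs in a set of small doubling have a popular difference, which provides \<open>y\<close>.\<close>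

lemma small_doubling_dilate:
  fixes K :: real
  assumes fin: "finite B" and ne: "B \<noteq> {}" and K: "card (diffs B) \<le> K * card B"
  obtains X y where "X \<subseteq> B" "card B / 2 \<le> card X"
    "card ((\<lambda>(z, x). z + (x - y) + (x - y)) ` (B \<times> X)) \<le> 4 * K ^ 4 * card B"
proof -
  let ?M = "real (card B)"
  have M: "?M > 0" using fin ne by (simp add: card_gt_0_iff)
  have "diffs B \<noteq> {}" using ne by (auto simp: diffs_def)
  then have "real (card (diffs B)) > 0" using fin by (simp add: card_gt_0_iff)
  then have Kpos: "K > 0" using K M by (smt (verit) zero_less_mult_pos2)
  \<comment> \<open>The unpopular differences cover at most \<open>K M * h\<close> pairs, which is half of all pairs for this threshold.\<close>
  define h where "h = ?M / (2 * K)"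
  have h: "h > 0" using M Kpos by (simp add: h_def)
  let ?pop = "\<lambda>d. h \<le> card (meet_shift B d)"
  let ?U = "{d \<in> diffs B. \<not> ?pop d}"
  have "card {p \<in> B \<times> B. fst p - snd p \<in> ?U} = (\<Sum>d\<in>?U. real (card (meet_shift B d)))"
    using fin by (subst card_pairs_diff_in) auto
  also have "\<dots> \<le> (\<Sum>d\<in>?U. h)" by (rule sum_mono) auto
  also have "\<dots> \<le> card (diffs B) * h"
    using fin h by (auto intro!: card_mono)
  also have "\<dots> \<le> K * ?M * h" using K h by (intro mult_right_mono) auto
  also have "\<dots> = ?M ^ 2 / 2" using Kpos by (simp add: h_def power2_eq_square)
  finally have unpop: "card {p \<in> B \<times> B. fst p - snd p \<in> ?U} \<le> ?M ^ 2 / 2" .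
  have "\<exists>y\<in>B. card {x \<in> B. x - y \<in> ?U} \<le> ?M / 2"
  proof (rule ccontr)
    assume "\<not> ?thesis"
    then have "(\<Sum>y\<in>B. ?M / 2) < (\<Sum>y\<in>B. real (card {x \<in> B. x - y \<in> ?U}))"
      using fin ne by (intro sum_strict_mono) auto
    also have "\<dots> = real (card (\<Union>y\<in>B. {x \<in> B. x - y \<in> ?U} \<times> {y}))"
      by (subst card_UN_disjoint) (use fin in \<open>auto simp: card_cartesian_product\<close>)
    also have "(\<Union>y\<in>B. {x \<in> B. x - y \<in> ?U} \<times> {y}) = {p \<in> B \<times> B. fst p - snd p \<in> ?U}" by auto
    finally show False using unpop by (simp add: power2_eq_square)
  qed
  then obtain y where y: "y \<in> B" and cy: "card {x \<in> B. x - y \<in> ?U} \<le> ?M / 2" by auto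
  define X where "X = {x \<in> B. ?pop (x - y)}"
  have XB: "X \<subseteq> B" by (auto simp: X_def)
  have "B - X = {x \<in> B. x - y \<in> ?U}" using y by (auto simp: X_def)
  then have cX: "?M / 2 \<le> card X"
    using cy card_Diff_subset[of X B] card_mono[OF fin XB] XB fin by (simp add: finite_subset)
  let ?E = "(\<lambda>(z, x). z + (x - y) + (x - y)) ` (B \<times> X)"
  have "card ?E * h ^ 2 \<le> card (diffs B \<times> diffs B \<times> B)"
  proof (rule card_mult_le_of_fibers[where f = "\<lambda>(u, v, w). u + v + w"])
    fix e assume "e \<in> ?E"
    then obtain z x where z: "z \<in> B" and x: "x \<in> X" and e: "e = z + (x - y) + (x - y)" by auto
    define s where "s = x - y"
    let ?S = "meet_shift B s"
    have "h ^ 2 \<le> real (card ?S) ^ 2" using x h by (intro power_mono) (auto simp: X_def s_def)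
    also have "\<dots> = card (?S \<times> ?S)" by (simp add: card_cartesian_product power2_eq_square)
    also have "card (?S \<times> ?S)
        \<le> card {t \<in> diffs B \<times> diffs B \<times> B. (case t of (u, v, w) \<Rightarrow> u + v + w) = e}"
      by (rule card_inj_on_le[where f = "\<lambda>(b, c). (z - (b - s), b - (c - s), c)"])
         (use z fin in \<open>auto simp: inj_on_def meet_shift_def e s_def[symmetric]\<close>)
    finally show "h ^ 2 \<le> card {t \<in> diffs B \<times> diffs B \<times> B. (case t of (u, v, w) \<Rightarrow> u + v + w) = e}"
      by simp
  qed (use fin XB in \<open>auto simp: finite_subset\<close>)
  also have "\<dots> = real (card (diffs B)) ^ 2 * ?M"
    by (simp add: card_cartesian_product power2_eq_square)
  also have "\<dots> \<le> (K * ?M) ^ 2 * ?M" using K by (intro mult_right_mono power_mono) auto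
  also have "\<dots> = 4 * K ^ 4 * ?M * h ^ 2"
    using Kpos by (simp add: h_def power2_eq_square power4_eq_xxxx)
  finally have "card ?E \<le> 4 * K ^ 4 * ?M" using h by simp
  with XB cX show thesis by (rule that)
qed

text \<open>The set \<open>A\<close> is the graph of an injective map from a subset of a group of exponent two to the integers.
  On a subset \<open>B\<close> of small doubling the map sending \<open>(z, x)\<close> to \<open>z + 2 (x - y)\<close> is injective, since
  doubling kills the first coordinate and is injective on the second, although by
  \<open>small_doubling_dilate\<close> it takes few values.\<close>

theorem card_le_of_energy_torsion_graph:
  fixes \<kappa> :: real and A :: "('a::ab_group_add \<times> int) set"
  assumes torsion: "\<And>a :: 'a. a + a = 0" and inj: "inj_on fst A" "inj_on snd A"
    and fin: "finite A" and pos: "\<kappa> > 0" and en: "\<kappa> * card A ^ 3 \<le> additive_energy A"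
  shows "card A \<le> 32 * (16384 / \<kappa> ^ 4) ^ 4 / \<kappa>"
proof (cases "A = {}")
  case True then show ?thesis using pos by simp
next
  case False
  define K where "K = 16384 / \<kappa> ^ 4"
  obtain B where B: "B \<subseteq> A" "\<kappa> / 4 * card A < card B" "card (diffs B) \<le> K * card B"
    using Balog_Szemeredi_Gowers[OF fin False pos en] unfolding K_def by metis
  have finB: "finite B" using B fin finite_subset by auto
  have Bpos: "real (card B) > 0" using B(2) pos by (smt (verit) of_nat_0_le_iff divide_pos_pos mult_nonneg_nonneg)
  then have "B \<noteq> {}" by auto
  from small_doubling_dilate[OF finB this B(3)] obtain X y where X: "X \<subseteq> B" "card B / 2 \<le> card X"
    and small: "card ((\<lambda>(z, x). z + (x - y) + (x - y)) ` (B \<times> X)) \<le> 4 * K ^ 4 * card B"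
    .
  have tor: "a - b + (a - b) = 0" for a b :: 'a using torsion by simp
  have "inj_on (\<lambda>(z, x). z + (x - y) + (x - y)) (B \<times> X)"
  proof (rule inj_onI)
    fix p q assume p: "p \<in> B \<times> X" and q: "q \<in> B \<times> X"
      and eq: "(case p of (z, x) \<Rightarrow> z + (x - y) + (x - y)) = (case q of (z, x) \<Rightarrow> z + (x - y) + (x - y))"
    obtain z x z' x' where pq: "p = (z, x)" "q = (z', x')" by (cases p, cases q) auto
    have zx: "z \<in> A" "x \<in> A" "z' \<in> A" "x' \<in> A" using p q pq B(1) X(1) by auto
    have "fst z + (fst x - fst y + (fst x - fst y)) = fst z' + (fst x' - fst y + (fst x' - fst y))"
      using arg_cong[OF eq, of fst] by (simp add: pq add.assoc)
    then have "fst z = fst z'" by (simp only: tor) simp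
    then have z: "z = z'" using zx inj(1) by (auto dest: inj_onD)
    with arg_cong[OF eq, of snd] have "snd x = snd x'" by (simp add: pq)
    then have "x = x'" using zx inj(2) by (auto dest: inj_onD)
    with z show "p = q" by (simp add: pq)
  qed
  then have "real (card B) * card X \<le> 4 * K ^ 4 * card B"
    using small by (simp add: card_image card_cartesian_product)
  then have "card X \<le> 4 * K ^ 4" using Bpos by (simp add: mult.commute[of "real (card B)"])
  then have "\<kappa> / 4 * card A \<le> 8 * K ^ 4" using B X by linarith
  then have "card A \<le> 32 * K ^ 4 / \<kappa>" using pos by (simp add: field_simps)
  then show ?thesis by (simp add: K_def)
qed

section \<open>Walsh polynomials whose coefficients are characters\<close>

text \<open>Walsh functions (for \<open>h i\<close> the Rademacher functions) and the characters of \<open>(\<nat>, \<oplus>)\<close> (for signs \<open>h i\<close>)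
  are both of this form.\<close>

definition bitprod :: "(nat \<Rightarrow> 'a) \<Rightarrow> nat \<Rightarrow> 'a::comm_ring_1" where
  "bitprod h k = (\<Prod>i | bit k i. h i)"

lemma finite_bits [simp]: "finite {i. bit (k::nat) i}"
proof (rule finite_subset)
  show "{i. bit k i} \<subseteq> {..<k}"
  proof (clarsimp)
    fix i assume "bit k i"
    then have "2 ^ i \<le> k" by (metis bit_iff_odd div_less even_zero not_less)
    then show "i < k" using less_exp[of i] by linarith
  qed
qed simp

lemma bit_nat_imp_less: "bit (k::nat) i \<Longrightarrow> k < 2 ^ n \<Longrightarrow> i < n"
  by (metis bit_take_bit_iff take_bit_nat_eq_self)

lemma bitprod_0 [simp]: "bitprod h 0 = 1"
  by (simp add: bitprod_def)

text \<open>Digits common to \<open>k\<close> and \<open>l\<close> contribute \<open>h i * h i = 1\<close> on the right-hand side.\<close>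

lemma bitprod_xor:
  assumes "\<And>i. h i * h i = 1"
  shows "bitprod h (k XOR l) = bitprod h k * bitprod h l"
proof -
  let ?B = "\<lambda>k. {i. bit (k::nat) i}"
  have k: "?B k = (?B k - ?B l) \<union> (?B k \<inter> ?B l)" and l: "?B l = (?B l - ?B k) \<union> (?B k \<inter> ?B l)"
    and x: "?B (k XOR l) = (?B k - ?B l) \<union> (?B l - ?B k)" by (auto simp: bit_xor_iff)
  let ?x = "prod h (?B k - ?B l)" and ?y = "prod h (?B l - ?B k)" and ?z = "prod h (?B k \<inter> ?B l)"
  have "prod h (?B k) = ?x * ?z"
    by (subst k, rule prod.union_disjoint) auto
  moreover have "prod h (?B l) = ?y * ?z"
    by (subst l, rule prod.union_disjoint) auto
  ultimately have "prod h (?B k) * prod h (?B l) = ?x * ?y * (?z * ?z)"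
    by (simp only: mult_ac)
  also have "?z * ?z = 1"
    by (simp add: assms flip: prod.distrib)
  also have "?x * ?y * 1 = prod h (?B (k XOR l))"
    by (subst x, subst prod.union_disjoint) auto
  finally show ?thesis by (simp add: bitprod_def)
qed

lemma bitprod_add_exp:
  assumes "k < 2 ^ n"
  shows "bitprod h (k + 2 ^ n) = bitprod h k * h n"
proof -
  have "{i. bit (k + 2 ^ n) i} = insert n {i. bit k i}"
  proof -
    have "k + 2 ^ n = k OR 2 ^ n"
      by (rule disjunctive_add) (use assms in \<open>auto simp: bit_exp_iff dest: bit_nat_imp_less\<close>)
    then show ?thesis by (auto simp: bit_or_iff bit_exp_iff)
  qed
  moreover have "n \<notin> {i. bit k i}" using assms bit_nat_imp_less by auto
  ultimately show ?thesis by (simp add: bitprod_def mult.commute)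
qed

text \<open>Expanding the product on the right picks from each factor \<open>1\<close> or \<open>h i\<close>, that is, a set of binary digits.\<close>

lemma sum_bitprod: "(\<Sum>k<2 ^ n. bitprod h k) = (\<Prod>i<n. 1 + h i)"
proof (induction n)
  case 0
  then show ?case by simp
next
  case (Suc n)
  have "{..<2 ^ Suc n} = {..<2 ^ n} \<union> (\<lambda>k. k + 2 ^ n) ` {..<2 ^ n :: nat}"
  proof -
    have "{2 ^ n..<2 ^ n + 2 ^ n} = (\<lambda>k. k + 2 ^ n) ` {0..<2 ^ n :: nat}"
      by (simp only: image_add_atLeastLessThan') simp
    then show ?thesis by (auto simp: lessThan_atLeast0 ivl_disj_un)
  qed
  then have "(\<Sum>k<2 ^ Suc n. bitprod h k) = (\<Sum>k<2 ^ n. bitprod h k) + (\<Sum>k\<in>(\<lambda>k. k + 2 ^ n) ` {..<2 ^ n}. bitprod h k)"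
    by (simp only:) (rule sum.union_disjoint, auto)
  also have "(\<Sum>k\<in>(\<lambda>k. k + 2 ^ n) ` {..<2 ^ n}. bitprod h k) = (\<Sum>k<2 ^ n. bitprod h k * h n)"
    by (subst sum.reindex) (auto simp: bitprod_add_exp)
  finally show ?case by (simp add: Suc.IH distrib_left flip: sum_distrib_right)
qed

text \<open>The character \<open>k \<mapsto> (-1) ^ j \<cdot> k\<close> of \<open>(\<nat>, \<oplus>)\<close>, where \<open>j \<cdot> k\<close> counts the common binary digits.\<close>

definition xor_char :: "nat \<Rightarrow> nat \<Rightarrow> real" where
  "xor_char j = bitprod (\<lambda>i. if bit j i then - 1 else 1)"

lemma xor_char_xor: "xor_char j (k XOR l) = xor_char j k * xor_char j l"
  unfolding xor_char_def by (rule bitprod_xor) auto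

lemma abs_xor_char [simp]: "\<bar>xor_char j k\<bar> = 1"
  unfolding xor_char_def bitprod_def abs_prod by (rule prod.neutral) auto

lemma xor_char_commute: "xor_char j k = xor_char k j"
proof -
  have "xor_char j k = (\<Prod>i\<in>{i. bit k i} \<inter> {i. bit j i}. - 1)" for j k
    unfolding xor_char_def bitprod_def by (rule prod.If_cases[THEN trans]) auto
  then show ?thesis by (metis Int_commute)
qed

lemma sum_xor_char:
  assumes "k < 2 ^ n"
  shows "(\<Sum>j<2 ^ n. xor_char j k) = (if k = 0 then 2 ^ n else 0)"
proof -
  have "(\<Sum>j<2 ^ n. xor_char j k) = (\<Sum>j<2 ^ n. xor_char k j)" by (simp add: xor_char_commute)
  also have "\<dots> = (\<Prod>i<n. 1 + (if bit k i then - 1 else 1))"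
    unfolding xor_char_def by (rule sum_bitprod)
  also have "\<dots> = (if k = 0 then 2 ^ n else 0)"
  proof (cases "k = 0")
    case False
    then obtain i where "bit k i" by (auto simp: bit_eq_iff)
    then have "i \<in> {..<n}" "1 + (if bit k i then - 1 else (1::real)) = 0"
      using assms bit_nat_imp_less by auto
    then show ?thesis using False by (metis (no_types, lifting) finite_lessThan prod_zero)
  qed simp
  finally show ?thesis .
qed

lemma xor_less_exp: "k < 2 ^ n \<Longrightarrow> l < 2 ^ n \<Longrightarrow> k XOR l < (2 ^ n :: nat)"
  by (metis take_bit_nat_eq_self_iff take_bit_xor)

lemma rademacher_measurable [measurable]: "rademacher i \<in> borel_measurable borel"
  unfolding rademacher_def by measurable

lemma walsh_measurable [measurable]: "walsh k \<in> borel_measurable borel"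
  unfolding walsh_def by measurable

lemma abs_rademacher_le: "\<bar>rademacher i t\<bar> \<le> 1"
  by (simp add: rademacher_def sgn_if)

lemma abs_walsh_le: "\<bar>walsh k t\<bar> \<le> 1"
  unfolding walsh_def abs_prod by (rule prod_le_1) (auto intro: abs_rademacher_le)

lemma rademacher_Suc_half: "rademacher (Suc i) (t / 2) = rademacher i t"
  by (simp add: rademacher_def field_simps)

lemma rademacher_Suc_add_half: "rademacher (Suc i) (t + 1 / 2) = rademacher (Suc i) t"
proof -
  have "sin (2 ^ (Suc i + 1) * pi * (t + 1 / 2)) = sin (2 ^ (Suc i + 1) * pi * t + real (2 ^ i) * (2 * pi))"
    by (simp add: algebra_simps)
  also have "\<dots> = sin (2 ^ (Suc i + 1) * pi * t)"
    using sin.plus_of_nat[of "2 ^ (Suc i + 1) * pi * t" "2 ^ i"] by simp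
  finally show ?thesis by (simp add: rademacher_def)
qed

lemma rademacher_0_add_half: "rademacher 0 (t + 1 / 2) = - rademacher 0 t"
proof -
  have "sin (2 * pi * (t + 1 / 2)) = - sin (2 * pi * t)"
    by (simp add: distrib_left sin_add)
  then show ?thesis by (simp add: rademacher_def sgn_minus)
qed

lemma walsh_double: "walsh (2 * k) (t / 2) = walsh k t"
proof -
  have "{i. bit (2 * k) i} = Suc ` {i. bit k i}"
  proof (rule set_eqI)
    show "i \<in> {i. bit (2 * k) i} \<longleftrightarrow> i \<in> Suc ` {i. bit k i}" for i
      by (cases i) (auto simp: bit_0 bit_Suc)
  qed
  then show ?thesis by (simp add: walsh_def prod.reindex rademacher_Suc_half)
qed

lemma walsh_add_half: "walsh k (t + 1 / 2) = (if odd k then - walsh k t else walsh k t)"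
proof -
  have step: "(\<Prod>i\<in>{i. bit k i} - {0}. rademacher i (t + 1 / 2)) = (\<Prod>i\<in>{i. bit k i} - {0}. rademacher i t)"
    by (rule prod.cong) (auto simp: gr0_conv_Suc intro: rademacher_Suc_add_half)
  show ?thesis
  proof (cases "odd k")
    case True
    then have "0 \<in> {i. bit k i}" by (simp add: bit_0)
    then show ?thesis using True step
      by (simp add: walsh_def prod.remove[of _ 0] rademacher_0_add_half)
  next
    case False
    then have "{i. bit k i} - {0} = {i. bit k i}" by (auto simp: bit_0)
    then show ?thesis using False step by (simp add: walsh_def)
  qed
qed

lemma walsh_integrable: "set_integrable lborel {a..b} (walsh k)"
  unfolding set_integrable_def
  by (rule integrableI_bounded_set_indicator[where B = 1]) (auto intro!: AE_I2 abs_walsh_le simp: emeasure_lborel_Icc_eq)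

text \<open>Translation by one half maps the left half of the interval to the right half and multiplies \<open>w\<^sub>k\<close> by
  \<open>-1\<close> if \<open>k\<close> is odd, so that the halves cancel. For even \<open>k\<close> the two halves agree, and each is a
  compressed copy of the Walsh function with index \<open>k / 2\<close>.\<close>

lemma integral_walsh: "(LINT t:{0..1}|lborel. walsh k t) = (if k = 0 then 1 else 0)"
proof -
  have HK: "(LINT t:{a..b}|lborel. walsh k t) = integral {a..b} (walsh k)" for a b k
    by (rule set_borel_integral_eq_integral(2)[OF walsh_integrable])
  have int: "walsh k integrable_on {a..b}" for a b k
    by (rule set_borel_integral_eq_integral(1)[OF walsh_integrable])
  have "integral {0..1} (walsh k) = (if k = 0 then 1 else 0)"
  proof (induction k rule: less_induct)
    case (less k)
    have "(walsh k has_integral integral {1/2..1} (walsh k)) (cbox (1/2) 1)"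
      using integrable_integral[OF int] by simp
    from has_integral_affinity'[OF this, of 1 "1/2"]
    have shift: "integral {1/2..1} (walsh k) = integral {0..1/2} (\<lambda>t. walsh k (t + 1/2))"
      by (simp add: integral_unique)
    have split: "integral {0..1} (walsh k) = integral {0..1/2} (walsh k) + integral {1/2..1} (walsh k)"
      using Henstock_Kurzweil_Integration.integral_combine[of 0 "1/2" 1 "walsh k"] int by simp
    show ?case
    proof (cases "odd k")
      case True
      then have "k \<noteq> 0" by (metis even_zero)
      then show ?thesis using split shift True by (simp add: walsh_add_half)
    next
      case False
      then obtain l where k: "k = 2 * l" by auto
      have "(walsh k has_integral integral {0..1/2} (walsh k)) (cbox 0 (1/2))"
        using integrable_integral[OF int] by simp
      from has_integral_affinity'[OF this, of "1/2" 0]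
      have half: "integral {0..1/2} (walsh k) = (1/2) * integral {0..1} (walsh l)"
        by (simp add: integral_unique k walsh_double)
      show ?thesis
      proof (cases "k = 0")
        case True then show ?thesis by (simp add: walsh_def)
      next
        case False
        then have "l < k" "l \<noteq> 0" using k by auto
        then show ?thesis using less[of l] split shift half \<open>\<not> odd k\<close> False by (simp add: walsh_add_half)
      qed
    qed
  qed
  then show ?thesis by (simp add: HK)
qed

text \<open>The sign function vanishes at dyadic rationals, which are the exceptional points here.\<close>

lemma AE_rademacher: "AE t in lborel. \<forall>i. rademacher i t ^ 2 = 1"
proof (subst AE_all_countable, rule allI)
  fix i
  have "{t. rademacher i t = 0} \<subseteq> range (\<lambda>z::int. z / 2 ^ (i + 1))"
  proof clarify
    fix t assume "rademacher i t = 0"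
    then have "sin (2 ^ (i + 1) * pi * t) = 0" by (simp add: rademacher_def sgn_zero_iff)
    then obtain z :: int where "2 ^ (i + 1) * pi * t = z * pi" by (auto simp: sin_zero_iff_int2)
    then have "2 ^ (i + 1) * t = z" using pi_neq_zero by (metis mult.commute mult.left_commute mult_cancel_left)
    then have "t = z / 2 ^ (i + 1)" by (simp add: field_simps)
    then show "t \<in> range (\<lambda>z::int. z / 2 ^ (i + 1))" by blast
  qed
  then have "countable {t. rademacher i t = 0}" by (rule countable_subset) simp
  then have "AE t in lborel. t \<notin> {t. rademacher i t = 0}"
    by (intro AE_not_in countable_imp_null_set_lborel)
  then show "AE t in lborel. rademacher i t ^ 2 = 1"
    by eventually_elim (auto simp: rademacher_def sgn_if split: if_splits)
qed

definition walsh_peak :: "nat \<Rightarrow> nat \<Rightarrow> real \<Rightarrow> real" where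
  "walsh_peak n j t = (\<Sum>k<2 ^ n. xor_char j k * walsh k t)"

lemma walsh_peak_eq_prod:
  "walsh_peak n j t = (\<Prod>i<n. 1 + (if bit j i then - 1 else 1) * rademacher i t)"
proof -
  have "xor_char j k * walsh k t = bitprod (\<lambda>i. (if bit j i then - 1 else 1) * rademacher i t) k" for k
    by (simp add: xor_char_def walsh_def bitprod_def flip: prod.distrib)
  then show ?thesis by (simp add: walsh_peak_def sum_bitprod)
qed

text \<open>Every factor \<open>1 \<plusminus> r\<^sub>i(t)\<close> is \<open>0\<close> or \<open>2\<close>.\<close>

lemma walsh_peak_values:
  assumes "\<forall>i. rademacher i t ^ 2 = 1"
  shows "walsh_peak n j t = 0 \<or> walsh_peak n j t = 2 ^ n"
proof (cases "\<exists>i<n. (if bit j i then - 1 else 1) * rademacher i t = - 1")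
  case True
  then obtain i where i: "i < n" "(if bit j i then - 1 else 1) * rademacher i t = - 1" by blast
  have "walsh_peak n j t = 0" unfolding walsh_peak_eq_prod
    by (rule prod_zero[OF finite_lessThan], rule bexI[of _ i]) (use i in simp_all)
  then show ?thesis ..
next
  case False
  have "(if bit j i then - 1 else 1) * rademacher i t = 1" if "i < n" for i
    using False that assms[rule_format, of i] by (auto simp: power2_eq_1_iff split: if_splits)
  then have "walsh_peak n j t = 2 ^ n" unfolding walsh_peak_eq_prod by simp
  then show ?thesis ..
qed

lemma integral_walsh_peak: "(LINT t:{0..1}|lborel. walsh_peak n j t) = 1"
proof -
  have "(LINT t:{0..1}|lborel. walsh_peak n j t)
      = (\<Sum>k<2 ^ n. LINT t:{0..1}|lborel. xor_char j k * walsh k t)"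
    unfolding walsh_peak_def set_lebesgue_integral_def scaleR_sum_right
  proof (rule Bochner_Integration.integral_sum)
    show "integrable lborel (\<lambda>t. indicator {0..1} t *\<^sub>R (xor_char j k * walsh k t))" for k
      using set_integrable_mult_right[OF walsh_integrable] unfolding set_integrable_def .
  qed
  also have "\<dots> = (\<Sum>k<2 ^ n. if k = (0::nat) then 1 else (0::real))"
    by (rule sum.cong) (auto simp: integral_walsh xor_char_def)
  finally show ?thesis by simp
qed

text \<open>A function with values \<open>0\<close> and \<open>N\<close> has a \<open>p\<close>-th power proportional to itself, so only its mean enters.\<close>

lemma Lp_norm_walsh_peak:
  assumes "p > 0"
  shows "Lp_norm p (\<lambda>t. complex_of_real (walsh_peak n j t)) powr p = (2 ^ n) powr (p - 1)"
proof -
  let ?N = "2 ^ n :: real"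
  have "(LINT t:{0..1}|lborel. norm (complex_of_real (walsh_peak n j t)) powr p)
      = (LINT t:{0..1}|lborel. ?N powr (p - 1) * walsh_peak n j t)"
    unfolding set_lebesgue_integral_def
  proof (rule integral_cong_AE)
    show "AE t in lborel. indicator {0..1} t *\<^sub>R norm (complex_of_real (walsh_peak n j t)) powr p
        = indicator {0..1} t *\<^sub>R (?N powr (p - 1) * walsh_peak n j t)"
      using AE_rademacher
    proof eventually_elim
      case (elim t)
      then have "walsh_peak n j t = 0 \<or> walsh_peak n j t = ?N" by (rule walsh_peak_values)
      then show ?case using assms by (auto simp: powr_diff)
    qed
  qed (auto simp: walsh_peak_def)
  also have "\<dots> = ?N powr (p - 1)" by (simp add: integral_walsh_peak)
  finally show ?thesis using assms by (simp add: Lp_norm_def powr_powr)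
qed

section \<open>The fourth moment of the corresponding trigonometric polynomials\<close>

lemma trig_eq_cis: "trig n t = cis (2 * pi * real n * t)"
  by (simp add: trig_def cis_conv_exp mult_ac)

lemma has_integral_cis:
  fixes m :: int
  shows "((\<lambda>t. cis (2 * pi * of_int m * t)) has_integral (if m = 0 then 1 else 0)) {0..1}"
proof (cases "m = 0")
  case True
  then show ?thesis using has_integral_const_real[of "1::complex" 0 1] by simp
next
  case False
  define w where "w = 2 * pi * of_int m"
  have w: "w \<noteq> 0" using False by (simp add: w_def)
  have "((\<lambda>t. cis (w * t)) has_integral (- \<i> * cis (w * 1) / w - (- \<i> * cis (w * 0) / w))) {0..1}"
  proof (rule fundamental_theorem_of_calculus)
    fix t :: real assume "t \<in> {0..1}"
    show "((\<lambda>t. - \<i> * cis (w * t) / w) has_vector_derivative cis (w * t)) (at t within {0..1})"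
      using w unfolding cis_conv_exp
      by (auto intro!: derivative_eq_intros has_vector_derivative_real_field simp: field_simps)
  qed simp
  moreover have "cis w = 1" unfolding w_def by (simp add: cis_multiple_2pi)
  ultimately show ?thesis using False by (simp add: w_def)
qed

text \<open>Frequencies may repeat: then Parseval's identity pairs all terms of equal frequency.\<close>

lemma has_integral_norm_sq_trig_sum:
  fixes a :: "'i \<Rightarrow> real" and m :: "'i \<Rightarrow> int"
  assumes "finite I"
  shows "((\<lambda>t. (norm (\<Sum>i\<in>I. of_real (a i) * cis (2 * pi * of_int (m i) * t)))\<^sup>2) has_integral
           (\<Sum>i\<in>I. \<Sum>j\<in>I. if m i = m j then a i * a j else 0)) {0..1}"
proof -
  let ?e = "\<lambda>m t. cis (2 * pi * of_int m * t)"
  let ?F = "\<lambda>t. \<Sum>i\<in>I. of_real (a i) * ?e (m i) t"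
  have expand: "?F t * cnj (?F t) = (\<Sum>i\<in>I. \<Sum>j\<in>I. of_real (a i * a j) * ?e (m i - m j) t)" for t
    by (simp add: sum_product cis_cnj cis_mult algebra_simps)
  have "((\<lambda>t. \<Sum>i\<in>I. \<Sum>j\<in>I. of_real (a i * a j) * ?e (m i - m j) t) has_integral
      (\<Sum>i\<in>I. \<Sum>j\<in>I. of_real (a i * a j) * (if m i - m j = 0 then 1 else 0))) {0..1}"
    by (intro has_integral_sum has_integral_mult_right has_integral_cis assms)
  then have "((\<lambda>t. ?F t * cnj (?F t)) has_integral
      (\<Sum>i\<in>I. \<Sum>j\<in>I. of_real (a i * a j) * (if m i - m j = 0 then 1 else 0))) {0..1}"
    by (simp only: expand)
  from has_integral_linear[OF this bounded_linear_Re]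
  have "((\<lambda>t. Re (?F t * cnj (?F t))) has_integral
      (\<Sum>i\<in>I. \<Sum>j\<in>I. Re (of_real (a i * a j) * (if m i - m j = 0 then 1 else 0)))) {0..1}"
    by (simp only: o_def Re_sum)
  moreover have "Re (?F t * cnj (?F t)) = (norm (?F t))\<^sup>2" for t
    by (simp only: complex_norm_square[symmetric] Re_complex_of_real)
  ultimately show ?thesis by (simp add: if_distrib cong: if_cong)
qed

text \<open>Below the threshold \<open>\<epsilon>\<close> the lower power dominates; above it both sides are compared with \<open>1\<close>.\<close>

lemma powr_le_add_fourth_power:
  fixes v \<epsilon> a b :: real
  assumes "0 \<le> v" "v \<le> 1" "0 < \<epsilon>" "0 < a" "a < b"
  shows "v powr b \<le> \<epsilon> powr (b - a) * v powr a + v ^ 4 / \<epsilon> ^ 4"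
proof (cases "v \<le> \<epsilon>")
  case True
  have "v powr b = v powr (b - a) * v powr a" by (simp flip: powr_add)
  also have "\<dots> \<le> \<epsilon> powr (b - a) * v powr a"
    using assms True by (intro mult_right_mono powr_mono2) auto
  finally show ?thesis using assms by (simp add: add_increasing2)
next
  case False
  have "v powr b \<le> 1" using assms by (intro powr_le1) auto
  also have "\<dots> \<le> v ^ 4 / \<epsilon> ^ 4"
    using False assms by (simp add: power_mono)
  finally show ?thesis using assms by (simp add: add_increasing)
qed

text \<open>On the set where \<open>v\<close> is below a small \<open>\<epsilon>\<close> the moment of order \<open>b\<close> is negligible against that of order
  \<open>a\<close>. So the values above \<open>\<epsilon>\<close> must carry at least half of \<open>\<beta> \<delta>\<close>, and they show up in the fourth
  moment. The lemma will be used with \<open>{a, b} = {2, p}\<close>, and so handles both \<open>p < 2\<close>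
  and \<open>p > 2\<close>.\<close>

lemma fourth_moment_lower_bound:
  fixes v :: "real \<Rightarrow> real"
  assumes cont: "continuous_on {0..1} v" and v: "\<And>t. 0 \<le> v t" "\<And>t. v t \<le> 1"
    and ab: "0 < a" "a < b" and pos: "\<alpha> > 0" "\<beta> > 0"
    and up: "integral {0..1} (\<lambda>t. v t powr a) \<le> \<alpha> * \<delta>"
    and low: "\<beta> * \<delta> \<le> integral {0..1} (\<lambda>t. v t powr b)"
  shows "\<beta> / 2 * (\<beta> / (2 * \<alpha>)) powr (4 / (b - a)) * \<delta> \<le> integral {0..1} (\<lambda>t. v t ^ 4)"
proof -
  \<comment> \<open>With this threshold the values below it account for at most \<open>\<beta> \<delta> / 2\<close> of the higher moment.\<close>
  define \<epsilon> where "\<epsilon> = (\<beta> / (2 * \<alpha>)) powr (1 / (b - a))"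
  have \<epsilon>: "\<epsilon> > 0" "\<epsilon> powr (b - a) = \<beta> / (2 * \<alpha>)" "\<epsilon> ^ 4 = (\<beta> / (2 * \<alpha>)) powr (4 / (b - a))"
    using pos ab by (auto simp: \<epsilon>_def powr_powr powr_power)
  have int: "(\<lambda>t. v t powr q) integrable_on {0..1}" if "q > 0" for q
    using that v by (intro integrable_continuous_real continuous_on_powr' cont continuous_on_const) auto
  have int4: "(\<lambda>t. v t ^ 4) integrable_on {0..1}"
    by (intro integrable_continuous_real continuous_intros cont)
  have "\<beta> * \<delta> \<le> integral {0..1} (\<lambda>t. v t powr b)" by (rule low)
  also have "\<dots> \<le> integral {0..1} (\<lambda>t. \<epsilon> powr (b - a) * v t powr a + v t ^ 4 / \<epsilon> ^ 4)"
    using ab \<epsilon>(1) v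
    by (intro integral_le int integrable_add integrable_on_mult_right integrable_on_divide int4
        powr_le_add_fourth_power) auto
  also have "\<dots> = \<epsilon> powr (b - a) * integral {0..1} (\<lambda>t. v t powr a) + integral {0..1} (\<lambda>t. v t ^ 4) / \<epsilon> ^ 4"
    using ab int int4 by (subst Henstock_Kurzweil_Integration.integral_add) (auto intro!: integrable_on_mult_right integrable_on_divide)
  also have "\<dots> \<le> \<epsilon> powr (b - a) * (\<alpha> * \<delta>) + integral {0..1} (\<lambda>t. v t ^ 4) / \<epsilon> ^ 4"
    using up by (intro add_right_mono mult_left_mono) auto
  also have "\<epsilon> powr (b - a) * (\<alpha> * \<delta>) = \<beta> / 2 * \<delta>" using pos by (simp add: \<epsilon>(2))
  finally have "\<beta> / 2 * \<delta> \<le> integral {0..1} (\<lambda>t. v t ^ 4) / \<epsilon> ^ 4" by linarith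
  then have "\<beta> / 2 * \<delta> * \<epsilon> ^ 4 \<le> integral {0..1} (\<lambda>t. v t ^ 4)"
    using \<epsilon>(1) by (simp only: pos_le_divide_eq zero_less_power)
  then show ?thesis by (simp only: \<epsilon>(3) mult_ac)
qed

definition trig_peak :: "(nat \<Rightarrow> nat) \<Rightarrow> nat \<Rightarrow> nat \<Rightarrow> real \<Rightarrow> complex" where
  "trig_peak \<sigma> n j t = (\<Sum>k<2 ^ n. of_real (xor_char j k) * trig (\<sigma> k) t)"

lemma continuous_on_trig_peak [continuous_intros]: "continuous_on S (trig_peak \<sigma> n j)"
  unfolding trig_peak_def trig_def by (intro continuous_intros)

lemma norm_trig_peak_le: "norm (trig_peak \<sigma> n j t) \<le> 2 ^ n"
proof -
  have "norm (trig_peak \<sigma> n j t) \<le> (\<Sum>k<(2::nat) ^ n. 1)"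
    unfolding trig_peak_def by (rule sum_norm_le) (simp add: norm_mult trig_eq_cis)
  then show ?thesis by simp
qed

lemma integral_norm_sq_trig_peak:
  assumes "inj \<sigma>"
  shows "integral {0..1} (\<lambda>t. (norm (trig_peak \<sigma> n j t))\<^sup>2) = 2 ^ n"
proof -
  have sq: "xor_char j k * xor_char j k = 1" for k using abs_xor_char[of j k] by (simp add: abs_if split: if_splits)
  have "integral {0..1} (\<lambda>t. (norm (trig_peak \<sigma> n j t))\<^sup>2)
      = (\<Sum>x<2 ^ n. \<Sum>y<2 ^ n. if x = y then xor_char j x * xor_char j y else 0)"
    using has_integral_norm_sq_trig_sum[of "{..<2 ^ n}" "xor_char j" "\<lambda>k. int (\<sigma> k)"] assms
    by (simp add: trig_peak_def trig_eq_cis integral_unique inj_eq)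
  also have "\<dots> = 2 ^ n" by (simp add: sq)
  finally show ?thesis .
qed

text \<open>Parseval's identity for \<open>|F|\<^sup>2\<close>, whose frequencies are the differences \<open>\<sigma> x - \<sigma> y\<close>.\<close>

lemma integral_norm_fourth_trig_peak:
  "integral {0..1} (\<lambda>t. norm (trig_peak \<sigma> n j t) ^ 4)
   = (\<Sum>(x, y)\<in>{..<2 ^ n} \<times> {..<2 ^ n}. \<Sum>(z, w)\<in>{..<2 ^ n} \<times> {..<2 ^ n}.
        if int (\<sigma> x) - int (\<sigma> y) = int (\<sigma> z) - int (\<sigma> w)
        then xor_char j (x XOR y XOR z XOR w) else 0)"
proof -
  let ?I = "{..<2 ^ n} \<times> {..<2 ^ n :: nat}"
  let ?a = "\<lambda>(x, y). xor_char j x * xor_char j y"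
  let ?m = "\<lambda>(x, y). int (\<sigma> x) - int (\<sigma> y)"
  have "norm (trig_peak \<sigma> n j t) ^ 4 = (norm (\<Sum>p\<in>?I. of_real (?a p) * cis (2 * pi * of_int (?m p) * t)))\<^sup>2" for t
  proof -
    have "trig_peak \<sigma> n j t * cnj (trig_peak \<sigma> n j t)
        = (\<Sum>x<2 ^ n. \<Sum>y<2 ^ n. of_real (xor_char j x * xor_char j y) * cis (2 * pi * of_int (int (\<sigma> x) - int (\<sigma> y)) * t))"
      by (simp add: trig_peak_def trig_eq_cis sum_product cis_cnj cis_mult algebra_simps)
    also have "\<dots> = (\<Sum>p\<in>?I. of_real (?a p) * cis (2 * pi * of_int (?m p) * t))"
      by (subst sum.cartesian_product) (rule sum.cong, auto)
    finally show ?thesis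
      by (metis (no_types, lifting) complex_mod_cnj norm_mult power2_eq_square power4_eq_xxxx mult.assoc)
  qed
  then have "integral {0..1} (\<lambda>t. norm (trig_peak \<sigma> n j t) ^ 4)
      = (\<Sum>p\<in>?I. \<Sum>q\<in>?I. if ?m p = ?m q then ?a p * ?a q else 0)"
    using integral_unique[OF has_integral_norm_sq_trig_sum[of ?I ?a ?m]] by simp
  also have "\<dots> = (\<Sum>(x, y)\<in>?I. \<Sum>(z, w)\<in>?I.
        if int (\<sigma> x) - int (\<sigma> y) = int (\<sigma> z) - int (\<sigma> w)
        then xor_char j (x XOR y XOR z XOR w) else 0)"
    by (intro sum.cong refl) (auto simp: xor_char_xor mult_ac intro!: sum.cong)
  finally show ?thesis .
qed

text \<open>Averaging over the characters enforces the dyadic relation among the indices, in addition to the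
  relation among the frequencies.\<close>

lemma sum_integral_norm_fourth_trig_peak:
  "(\<Sum>j<2 ^ n. integral {0..1} (\<lambda>t. norm (trig_peak \<sigma> n j t) ^ 4))
   = 2 ^ n * real (card {((x, y), (z, w)). x < 2 ^ n \<and> y < 2 ^ n \<and> z < 2 ^ n \<and> w < 2 ^ n \<and>
        int (\<sigma> x) - int (\<sigma> y) = int (\<sigma> z) - int (\<sigma> w) \<and> x XOR y XOR z XOR w = 0})"
  (is "_ = _ * real (card ?Q)")
proof -
  let ?I = "{..<2 ^ n} \<times> {..<2 ^ n :: nat}"
  let ?S = "\<lambda>p q. int (\<sigma> (fst p)) - int (\<sigma> (snd p)) = int (\<sigma> (fst q)) - int (\<sigma> (snd q))"
  let ?x = "\<lambda>p q. fst p XOR snd p XOR fst q XOR (snd q :: nat)"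
  have inner: "(\<Sum>j<2 ^ n. if S then xor_char j k else 0) = (if S \<and> k = 0 then 2 ^ n else 0)"
    if "k < 2 ^ n" for S k
    using that by (cases S) (auto simp: sum_xor_char)
  have "(\<Sum>j<2 ^ n. integral {0..1} (\<lambda>t. norm (trig_peak \<sigma> n j t) ^ 4))
      = (\<Sum>j<2 ^ n. \<Sum>p\<in>?I. \<Sum>q\<in>?I. if ?S p q then xor_char j (?x p q) else 0)"
    by (simp add: integral_norm_fourth_trig_peak split_def)
  also have "\<dots> = (\<Sum>p\<in>?I. \<Sum>q\<in>?I. \<Sum>j<2 ^ n. if ?S p q then xor_char j (?x p q) else 0)"
    by (subst sum.swap, rule sum.cong[OF refl], rule sum.swap)
  also have "\<dots> = (\<Sum>p\<in>?I. \<Sum>q\<in>?I. if ?S p q \<and> ?x p q = 0 then 2 ^ n else 0)"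
    by (intro sum.cong refl inner xor_less_exp) auto
  also have "\<dots> = (\<Sum>r\<in>?I \<times> ?I. if ?S (fst r) (snd r) \<and> ?x (fst r) (snd r) = 0 then 2 ^ n else 0)"
    by (subst sum.cartesian_product) (simp add: split_def)
  also have "\<dots> = 2 ^ n * real (card {r \<in> ?I \<times> ?I. ?S (fst r) (snd r) \<and> ?x (fst r) (snd r) = 0})"
    by (simp add: sum.If_cases Int_def)
  also have "{r \<in> ?I \<times> ?I. ?S (fst r) (snd r) \<and> ?x (fst r) (snd r) = 0} = ?Q" by auto
  finally show ?thesis .
qed

text \<open>The function \<open>v = |F| / 2 ^ n\<close> has second moment \<open>2 ^ (-n)\<close> by orthogonality. Its \<open>p\<close>-th moment has the
  same order, because equivalence transfers it from the Walsh polynomial with the same coefficients.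
  The constant does not depend on the sign pattern \<open>j\<close>, so the bound can be averaged over \<open>j\<close>.\<close>

lemma equivalent_imp_fourth_moment:
  assumes p: "1 < p" "p \<noteq> 2" and inj: "inj \<sigma>"
    and eq: "equivalent_Lp p (\<lambda>k. trig (\<sigma> k)) (\<lambda>k t. complex_of_real (walsh k t))"
  obtains C where "C > 0" "\<And>n j. C * 8 ^ n \<le> integral {0..1} (\<lambda>t. norm (trig_peak \<sigma> n j t) ^ 4)"
proof -
  obtain c where c: "c > 0" and norms: "\<And>\<xi> :: nat \<Rightarrow> complex. finite {k. \<xi> k \<noteq> 0} \<Longrightarrow>
        1 / c * Lp_norm p (\<lambda>t. \<Sum>k | \<xi> k \<noteq> 0. \<xi> k * trig (\<sigma> k) t)
          \<le> Lp_norm p (\<lambda>t. \<Sum>k | \<xi> k \<noteq> 0. \<xi> k * of_real (walsh k t)) \<and>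
        Lp_norm p (\<lambda>t. \<Sum>k | \<xi> k \<noteq> 0. \<xi> k * of_real (walsh k t))
          \<le> c * Lp_norm p (\<lambda>t. \<Sum>k | \<xi> k \<noteq> 0. \<xi> k * trig (\<sigma> k) t)"
    using eq unfolding equivalent_Lp_def by blast
  define v where "v n j t = norm (trig_peak \<sigma> n j t) / 2 ^ n" for n j t
  have v: "0 \<le> v n j t" "v n j t \<le> 1" for n j t
    using norm_trig_peak_le[of \<sigma> n j t] by (auto simp: v_def)
  have cont: "continuous_on {0..1} (v n j)" for n j
    unfolding v_def by (intro continuous_intros) auto
  have v2: "integral {0..1} (\<lambda>t. v n j t powr 2) = 1 / 2 ^ n" for n j
  proof -
    have "(\<lambda>t. v n j t powr 2) = (\<lambda>t. (norm (trig_peak \<sigma> n j t))\<^sup>2 / (2 ^ n)\<^sup>2)"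
      using v by (simp add: fun_eq_iff powr_numeral) (simp add: v_def power_divide)
    then show ?thesis using integral_norm_sq_trig_peak[OF inj, of n j] by (simp add: power2_eq_square)
  qed
  have vp: "integral {0..1} (\<lambda>t. v n j t powr p) \<le> c powr p * (1 / 2 ^ n)"
    "c powr (- p) * (1 / 2 ^ n) \<le> integral {0..1} (\<lambda>t. v n j t powr p)" for n j
  proof -
    let ?N = "2 ^ n :: real"
    let ?T = "Lp_norm p (trig_peak \<sigma> n j)" and ?W = "Lp_norm p (\<lambda>t. complex_of_real (walsh_peak n j t))"
    let ?\<xi> = "\<lambda>k. if k < 2 ^ n then complex_of_real (xor_char j k) else 0"
    have char_nonzero: "xor_char j k \<noteq> 0" for k by (metis abs_xor_char abs_zero zero_neq_one)
    then have supp: "{k. ?\<xi> k \<noteq> 0} = {..<2 ^ n}" by auto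
    have TW: "?T \<le> c * ?W" "?W \<le> c * ?T"
      using norms[of ?\<xi>] c unfolding supp
      by (simp_all add: trig_peak_def[abs_def] walsh_peak_def[abs_def] field_simps)
    have nonneg: "?T \<ge> 0" "?W \<ge> 0" by (auto simp: Lp_norm_def)
    have "continuous_on {0..1} (\<lambda>t. norm (trig_peak \<sigma> n j t) powr p)"
      using p by (intro continuous_on_powr' continuous_intros) auto
    then have "set_integrable lborel {0..1} (\<lambda>t. norm (trig_peak \<sigma> n j t) powr p)"
      by (rule borel_integrable_atLeastAtMost')
    then have T: "?T powr p = integral {0..1} (\<lambda>t. norm (trig_peak \<sigma> n j t) powr p)"
      using p by (simp add: Lp_norm_def powr_powr set_borel_integral_eq_integral(2) integral_nonneg
            set_borel_integral_eq_integral(1))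
    have W: "?W powr p = ?N powr (p - 1)"
      using p by (intro Lp_norm_walsh_peak) auto
    have int: "integral {0..1} (\<lambda>t. v n j t powr p) = ?T powr p / ?N powr p"
      by (simp add: T v_def powr_divide)
    have N: "?N powr (p - 1) / ?N powr p = 1 / ?N" by (simp flip: powr_diff add: powr_minus_divide)
    have "?T powr p \<le> (c * ?W) powr p" using TW nonneg p by (intro powr_mono2) auto
    also have "\<dots> = c powr p * ?N powr (p - 1)" using c nonneg by (simp add: powr_mult W)
    finally have "?T powr p / ?N powr p \<le> c powr p * ?N powr (p - 1) / ?N powr p"
      by (intro divide_right_mono) auto
    then show "integral {0..1} (\<lambda>t. v n j t powr p) \<le> c powr p * (1 / 2 ^ n)"
      by (simp only: int N flip: times_divide_eq_right)
    have "?N powr (p - 1) \<le> (c * ?T) powr p" unfolding W[symmetric] using TW nonneg p by (intro powr_mono2) auto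
    also have "\<dots> = c powr p * ?T powr p" using c nonneg by (simp add: powr_mult)
    finally have "c powr (- p) * ?N powr (p - 1) \<le> ?T powr p"
      using c by (simp add: powr_minus field_simps)
    then have "c powr (- p) * ?N powr (p - 1) / ?N powr p \<le> ?T powr p / ?N powr p"
      by (intro divide_right_mono) auto
    then show "c powr (- p) * (1 / 2 ^ n) \<le> integral {0..1} (\<lambda>t. v n j t powr p)"
      by (simp only: int N flip: times_divide_eq_right)
  qed
  have "\<exists>C>0. \<forall>n j. C * (1 / 2 ^ n) \<le> integral {0..1} (\<lambda>t. v n j t ^ 4)"
  proof (cases "p < 2")
    case True
    have "1 / 2 * (1 / (2 * c powr p)) powr (4 / (2 - p)) * (1 / 2 ^ n) \<le> integral {0..1} (\<lambda>t. v n j t ^ 4)" for n j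
      by (rule fourth_moment_lower_bound[OF cont v _ True _ _ vp(1)]) (use p c v2 in auto)
    moreover have "1 / 2 * (1 / (2 * c powr p)) powr (4 / (2 - p)) > 0" using c by simp
    ultimately show ?thesis by blast
  next
    case False
    with p have p2: "2 < p" by simp
    have "c powr (- p) / 2 * (c powr (- p) / (2 * 1)) powr (4 / (p - 2)) * (1 / 2 ^ n) \<le> integral {0..1} (\<lambda>t. v n j t ^ 4)" for n j
      by (rule fourth_moment_lower_bound[OF cont v _ p2 _ _ _ vp(2)]) (use p c v2 in auto)
    moreover have "c powr (- p) / 2 * (c powr (- p) / (2 * 1)) powr (4 / (p - 2)) > 0" using c by simp
    ultimately show ?thesis by blast
  qed
  then obtain C where C: "C > 0" "\<And>n j. C * (1 / 2 ^ n) \<le> integral {0..1} (\<lambda>t. v n j t ^ 4)" by blast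
  have "C * 8 ^ n \<le> integral {0..1} (\<lambda>t. norm (trig_peak \<sigma> n j t) ^ 4)" for n j
  proof -
    have "C * (1 / 2 ^ n) * (2 ^ n) ^ 4 \<le> integral {0..1} (\<lambda>t. v n j t ^ 4) * (2 ^ n) ^ 4"
      using C(2) by (intro mult_right_mono) auto
    also have "\<dots> = integral {0..1} (\<lambda>t. norm (trig_peak \<sigma> n j t) ^ 4)"
      by (simp add: v_def power_divide)
    also have "C * (1 / 2 ^ n) * (2 ^ n) ^ 4 = C * ((2 ^ n) ^ 3)" by (simp add: eval_nat_numeral)
    also have "(2 ^ n) ^ 3 = (8 ^ n :: real)" by (simp add: power_mult[symmetric] mult.commute[of n]) (simp add: power_mult)
    finally show ?thesis .
  qed
  with C(1) show thesis by (rule that)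
qed

section \<open>Nonequivalence\<close>

text \<open>Binary expansion as a vector over the field with two elements; it turns the dyadic sum into the
  addition of an abelian group.\<close>

definition bitvec :: "nat \<Rightarrow> nat \<Rightarrow> bit" where
  "bitvec k i = of_bool (bit k i)"

lemma bitvec_diff: "bitvec x - bitvec y = bitvec (x XOR y)"
  by (rule ext) (simp add: bitvec_def bit_xor_iff)

lemma inj_bitvec: "inj bitvec"
proof (rule injI)
  fix x y assume "bitvec x = bitvec y"
  then have "bit x i = bit y i" for i by (auto dest: fun_cong[of _ _ i] simp: bitvec_def)
  then show "x = y" by (intro bit_eqI)
qed

lemma bitvec_diff_eq_iff: "bitvec x - bitvec y = bitvec z - bitvec w \<longleftrightarrow> x XOR y XOR z XOR w = 0"
proof -
  have "bitvec x - bitvec y = bitvec z - bitvec w \<longleftrightarrow> x XOR y = z XOR w"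
    by (simp only: bitvec_diff inj_eq[OF inj_bitvec])
  also have "\<dots> \<longleftrightarrow> x XOR y XOR z XOR w = 0"
    by (auto simp: bit_eq_iff bit_xor_iff)
  finally show ?thesis .
qed

text \<open>Equivalence would give the graph of \<open>\<sigma>\<close> on \<open>[2 ^ n]\<close> an additive energy of at least \<open>C * 8 ^ n\<close> for
  every \<open>n\<close>, with the same \<open>C > 0\<close>, contrary to \<open>card_le_of_energy_torsion_graph\<close>.\<close>

theorem not_equivalent_trig_walsh:
  assumes p: "1 < p" "p \<noteq> 2" and inj: "inj \<sigma>"
  shows "\<not> equivalent_Lp p (\<lambda>k. trig (\<sigma> k)) (\<lambda>k t. complex_of_real (walsh k t))"
proof
  assume "equivalent_Lp p (\<lambda>k. trig (\<sigma> k)) (\<lambda>k t. complex_of_real (walsh k t))"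
  from equivalent_imp_fourth_moment[OF p inj this] obtain C where C: "C > 0"
    "\<And>n j. C * 8 ^ n \<le> integral {0..1} (\<lambda>t. norm (trig_peak \<sigma> n j t) ^ 4)" by blast
  define g where "g k = (bitvec k, int (\<sigma> k))" for k
  have inj_g: "inj g" by (auto simp: inj_def g_def dest: injD[OF inj])
  have "2 ^ n \<le> 32 * (16384 / C ^ 4) ^ 4 / C" for n
  proof -
    let ?A = "g ` {..<2 ^ n}"
    let ?Q = "{((x, y), (z, w)). x < 2 ^ n \<and> y < 2 ^ n \<and> z < 2 ^ n \<and> w < 2 ^ n \<and>
        int (\<sigma> x) - int (\<sigma> y) = int (\<sigma> z) - int (\<sigma> w) \<and> x XOR y XOR z XOR w = 0}"
    have card_A: "card ?A = 2 ^ n"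
      using inj_g by (subst card_image) (auto intro: inj_on_subset)
    have "2 ^ n * (C * 8 ^ n) = (\<Sum>j<(2::nat) ^ n. C * 8 ^ n)" by simp
    also have "\<dots> \<le> (\<Sum>j<2 ^ n. integral {0..1} (\<lambda>t. norm (trig_peak \<sigma> n j t) ^ 4))"
      by (rule sum_mono) (rule C(2))
    also have "\<dots> = 2 ^ n * card ?Q" by (simp add: sum_integral_norm_fourth_trig_peak)
    finally have "C * 8 ^ n \<le> card ?Q" by simp
    also have "card ?Q \<le> additive_energy ?A"
      unfolding additive_energy_def
    proof (rule card_inj_on_le[where f = "map_prod (map_prod g g) (map_prod g g)"])
      show "inj_on (map_prod (map_prod g g) (map_prod g g)) ?Q"
        using prod.inj_map[OF prod.inj_map[OF inj_g inj_g] prod.inj_map[OF inj_g inj_g]]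
        by (rule inj_on_subset) simp
      show "map_prod (map_prod g g) (map_prod g g) ` ?Q
          \<subseteq> {((a, b), (c, d)). a \<in> ?A \<and> b \<in> ?A \<and> c \<in> ?A \<and> d \<in> ?A \<and> a - b = c - d}"
        by (auto simp: g_def bitvec_diff_eq_iff)
      show "finite {((a, b), (c, d)). a \<in> ?A \<and> b \<in> ?A \<and> c \<in> ?A \<and> d \<in> ?A \<and> a - b = c - d}"
        by (rule finite_subset[of _ "(?A \<times> ?A) \<times> (?A \<times> ?A)"]) auto
    qed
    finally have "C * card ?A ^ 3 \<le> additive_energy ?A"
      by (simp add: card_A power_mult[symmetric] mult.commute[of n]) (simp add: power_mult)
    moreover have "a + a = 0" for a :: "nat \<Rightarrow> bit" by (rule ext) simp
    moreover have "inj_on fst ?A" "inj_on snd ?A"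
      by (auto simp: inj_on_def g_def dest: injD[OF inj_bitvec] injD[OF inj])
    ultimately have "card ?A \<le> 32 * (16384 / C ^ 4) ^ 4 / C"
      using C(1) by (intro card_le_of_energy_torsion_graph) auto
    then show ?thesis by (simp add: card_A)
  qed
  moreover obtain n where "32 * (16384 / C ^ 4) ^ 4 / C < 2 ^ n"
    using real_arch_pow[of 2] by auto
  ultimately show False by (metis not_less)
qed

section \<open>Dyadically linear permutations\<close>

text \<open>Fix a digit \<open>i\<close> that is not constant on \<open>V\<close>. It splits each of the cosets \<open>V \<oplus> a\<close> and \<open>V \<oplus> b\<close> into two
  cosets of the subspace \<open>W\<close> of half the size, and of the four pairs of such cosets the one in which
  both entries have digit \<open>i\<close> contains no disjoint pair. Cosets appear in the statement because the
  induction produces them.\<close>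

lemma card_disjoint_pairs_le:
  fixes V :: "nat set"
  assumes "\<And>u v. u \<in> V \<Longrightarrow> v \<in> V \<Longrightarrow> u XOR v \<in> V" and "card V = 2 ^ n"
  shows "card {(u, v). u \<in> V \<and> v \<in> V \<and> (u XOR a) AND (v XOR b) = 0} \<le> 3 ^ n"
  using assms
proof (induction n arbitrary: V a b)
  case 0
  then have fin: "finite V" by (metis card.infinite power_0 zero_neq_one)
  have "card {(u, v). u \<in> V \<and> v \<in> V \<and> (u XOR a) AND (v XOR b) = 0} \<le> card (V \<times> V)"
    using fin by (intro card_mono) auto
  then show ?case using 0 by (simp add: card_cartesian_product)
next
  case (Suc n)
  have fin: "finite V" using Suc.prems(2) by (metis card.infinite power_eq_0_iff zero_neq_numeral)
  have "\<not> V \<subseteq> {0}"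
  proof
    assume "V \<subseteq> {0}"
    then have "card V \<le> 1" using card_mono[of "{0}" V] by simp
    moreover have "(1::nat) \<le> 2 ^ n" by simp
    ultimately show False using Suc.prems(2) unfolding power_Suc by linarith
  qed
  then obtain e where e: "e \<in> V" "e \<noteq> 0" by auto
  then obtain i where i: "bit e i" by (auto simp: bit_eq_iff)
  have zero: "0 \<in> V" using Suc.prems(1)[OF e(1) e(1)] by simp
  define W where "W = {v \<in> V. \<not> bit v i}"
  have WV: "W \<subseteq> V" by (auto simp: W_def)
  have "V - W = (\<lambda>v. v XOR e) ` W"
  proof
    show "V - W \<subseteq> (\<lambda>v. v XOR e) ` W"
    proof
      fix v assume "v \<in> V - W"
      then have "v XOR e \<in> W" using Suc.prems(1) e i by (auto simp: W_def bit_xor_iff)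
      then show "v \<in> (\<lambda>v. v XOR e) ` W" by (intro image_eqI[of _ _ "v XOR e"]) (simp_all add: xor.assoc)
    qed
  qed (use Suc.prems(1) e i in \<open>auto simp: W_def bit_xor_iff\<close>)
  moreover have "inj_on (\<lambda>v. v XOR e) W"
    by (rule inj_on_inverseI[where g = "\<lambda>v. v XOR e"]) (simp add: xor.assoc)
  ultimately have "card (V - W) = card W" by (simp add: card_image)
  then have card_W: "card W = 2 ^ n"
    using Suc.prems(2) card_Diff_subset[of W V] card_mono[OF fin WV] finite_subset[OF WV fin] WV by simp
  have W_closed: "u XOR v \<in> W" if "u \<in> W" "v \<in> W" for u v
    using that Suc.prems(1) by (auto simp: W_def bit_xor_iff)
  let ?Q = "\<lambda>\<alpha> \<beta>. {(u, v). u \<in> W \<and> v \<in> W \<and> (u XOR (\<alpha> XOR a)) AND (v XOR (\<beta> XOR b)) = 0}"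
  let ?f = "\<lambda>\<alpha> \<beta>. map_prod (\<lambda>u. u XOR \<alpha>) (\<lambda>v. v XOR \<beta>)"
  have finQ: "finite (?Q \<alpha> \<beta>)" for \<alpha> \<beta>
    by (rule finite_subset[of _ "W \<times> W"]) (use finite_subset[OF WV fin] in auto)
  have card_fQ: "card (?f \<alpha> \<beta> ` ?Q \<alpha> \<beta>) \<le> 3 ^ n" for \<alpha> \<beta>
    using card_image_le[OF finQ] Suc.IH[OF W_closed card_W] by (rule order_trans)
  \<comment> \<open>Shifts by \<open>\<alpha>0\<close> (\<open>\<alpha>1\<close>) move into \<open>W\<close> those \<open>u\<close> for which digit \<open>i\<close> of \<open>u \<oplus> a\<close> is zero (one); likewise for \<open>v\<close> and \<open>b\<close>.\<close>
  define \<alpha>0 \<alpha>1 \<beta>0 \<beta>1 where "\<alpha>0 = (if bit a i then e else 0)" and "\<alpha>1 = (if bit a i then 0 else e)"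
    and "\<beta>0 = (if bit b i then e else 0)" and "\<beta>1 = (if bit b i then 0 else e)"
  note greek = \<alpha>0_def \<alpha>1_def \<beta>0_def \<beta>1_def
  have "{(u, v). u \<in> V \<and> v \<in> V \<and> (u XOR a) AND (v XOR b) = 0}
      \<subseteq> ?f \<alpha>0 \<beta>0 ` ?Q \<alpha>0 \<beta>0 \<union> ?f \<alpha>0 \<beta>1 ` ?Q \<alpha>0 \<beta>1 \<union> ?f \<alpha>1 \<beta>0 ` ?Q \<alpha>1 \<beta>0" (is "?P \<subseteq> ?R")
  proof (rule subrelI)
    fix u v assume "(u, v) \<in> ?P"
    then have uv: "u \<in> V" "v \<in> V" "(u XOR a) AND (v XOR b) = 0" by auto
    have mem: "(u, v) \<in> ?f \<alpha> \<beta> ` ?Q \<alpha> \<beta>" if "u XOR \<alpha> \<in> W" "v XOR \<beta> \<in> W" for \<alpha> \<beta>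
      by (rule image_eqI[of _ _ "(u XOR \<alpha>, v XOR \<beta>)"])
         (use that uv(3) in \<open>simp_all add: xor.assoc xor_self_eq flip: xor.assoc[of \<alpha>] xor.assoc[of \<beta>]\<close>)
    have "\<not> (bit (u XOR a) i \<and> bit (v XOR b) i)"
      using arg_cong[OF uv(3), of "\<lambda>k. bit k i"] by (simp add: bit_and_iff)
    moreover have "u XOR \<alpha>0 \<in> W" if "\<not> bit (u XOR a) i"
      using that uv zero e i Suc.prems(1) by (auto simp: W_def greek bit_xor_iff)
    moreover have "u XOR \<alpha>1 \<in> W" if "bit (u XOR a) i"
      using that uv zero e i Suc.prems(1) by (auto simp: W_def greek bit_xor_iff)
    moreover have "v XOR \<beta>0 \<in> W" if "\<not> bit (v XOR b) i"
      using that uv zero e i Suc.prems(1) by (auto simp: W_def greek bit_xor_iff)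
    moreover have "v XOR \<beta>1 \<in> W" if "bit (v XOR b) i"
      using that uv zero e i Suc.prems(1) by (auto simp: W_def greek bit_xor_iff)
    ultimately show "(u, v) \<in> ?R" using mem by (metis (no_types, lifting) UnI1 UnI2)
  qed
  then have "card ?P \<le> card ?R" by (rule card_mono[rotated]) (use finQ in auto)
  also have "\<dots> \<le> card (?f \<alpha>0 \<beta>0 ` ?Q \<alpha>0 \<beta>0) + card (?f \<alpha>0 \<beta>1 ` ?Q \<alpha>0 \<beta>1) + card (?f \<alpha>1 \<beta>0 ` ?Q \<alpha>1 \<beta>0)"
    by (rule order_trans[OF card_Un_le add_right_mono[OF card_Un_le]])
  also have "\<dots> \<le> 3 ^ n + 3 ^ n + 3 ^ n" by (intro add_mono card_fQ)
  finally show ?case by simp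
qed

lemma add_eq_xor_plus_and: "(a::nat) + b = (a XOR b) + 2 * (a AND b)"
proof -
  have "int a + int b = int ((a AND b) + (a OR b))"
    by (simp add: of_nat_and_eq of_nat_or_eq plus_and_or)
  then have "a + b = (a AND b) + (a OR b)" by linarith
  moreover have "(a XOR b) + (a AND b) = (a XOR b) OR (a AND b)"
    by (rule disjunctive_add) (auto simp: bit_xor_iff bit_and_iff)
  moreover have "(a XOR b) OR (a AND b) = a OR b"
    by (rule bit_eqI) (auto simp: bit_or_iff bit_xor_iff bit_and_iff)
  ultimately show ?thesis by simp
qed

text \<open>With \<open>d = a \<oplus> b \<oplus> c\<close> the pairs \<open>a, b\<close> and \<open>c, d\<close> have the same sum and the same dyadic sum, hence
  the same common digits. A digit at which \<open>c\<close> differs from both \<open>a\<close> and \<open>b\<close> would be common to exactly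
  one of the two pairs.\<close>

lemma disjoint_of_add_eq_xor:
  fixes a b c :: nat
  assumes "a + b = c + (a XOR b XOR c)"
  shows "(a XOR c) AND (b XOR c) = 0"
proof -
  let ?d = "a XOR b XOR c"
  have "c XOR ?d = a XOR b" by (rule bit_eqI) (auto simp: bit_xor_iff)
  then have "a AND b = c AND ?d"
    using assms add_eq_xor_plus_and[of a b] add_eq_xor_plus_and[of c ?d] by simp
  then have "bit (a AND b) i = bit (c AND ?d) i" for i by simp
  then show ?thesis by (intro bit_eqI) (auto simp: bit_and_iff bit_xor_iff)
qed

text \<open>A triple is determined by \<open>\<pi> z\<close>, for which there are \<open>2 ^ n\<close> choices, and the disjoint pair
  \<open>\<pi> x \<oplus> \<pi> z\<close>, \<open>\<pi> y \<oplus> \<pi> z\<close> in the image of \<open>[2 ^ n]\<close>.\<close>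

lemma card_A_hat_dyadically_linear_le:
  assumes inj: "inj \<pi>" and lin: "dyadically_linear \<pi>"
  shows "card (A_hat \<pi> n) \<le> 6 ^ n"
proof -
  let ?V = "\<pi> ` {..<2 ^ n}"
  let ?D = "{(u, v). u \<in> ?V \<and> v \<in> ?V \<and> (u XOR 0) AND (v XOR 0) = 0}"
  have hom: "\<pi> (x XOR y) = \<pi> x XOR \<pi> y" for x y using lin by (simp add: dyadically_linear_def)
  have closed: "u XOR v \<in> ?V" if "u \<in> ?V" "v \<in> ?V" for u v
    using that by (auto simp: xor_less_exp hom[symmetric])
  have card_V: "card ?V = 2 ^ n"
    using inj by (subst card_image) (auto intro: inj_on_subset)
  have finD: "finite ?D" by (rule finite_subset[of _ "?V \<times> ?V"]) auto
  have "card (A_hat \<pi> n) \<le> card (?V \<times> ?D)"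
  proof (rule card_inj_on_le[where f = "\<lambda>(x, y, z). (\<pi> z, \<pi> x XOR \<pi> z, \<pi> y XOR \<pi> z)"])
    show "(\<lambda>(x, y, z). (\<pi> z, \<pi> x XOR \<pi> z, \<pi> y XOR \<pi> z)) ` A_hat \<pi> n \<subseteq> ?V \<times> ?D"
    proof (rule image_subsetI)
      fix t assume t: "t \<in> A_hat \<pi> n"
      obtain x y z where xyz: "t = (x, y, z)" by (cases t) auto
      with t have less: "x < 2 ^ n" "y < 2 ^ n" "z < 2 ^ n"
        and "int (\<pi> x) + int (\<pi> y) - int (\<pi> z) = int (\<pi> x XOR \<pi> y XOR \<pi> z)"
        by (auto simp: A_hat_def hom)
      then have "\<pi> x + \<pi> y = \<pi> z + (\<pi> x XOR \<pi> y XOR \<pi> z)" by linarith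
      then have "(\<pi> x XOR \<pi> z) AND (\<pi> y XOR \<pi> z) = 0" by (rule disjoint_of_add_eq_xor)
      moreover have "\<pi> x XOR \<pi> z \<in> ?V" "\<pi> y XOR \<pi> z \<in> ?V" "\<pi> z \<in> ?V"
        using less closed by auto
      ultimately show "(case t of (x, y, z) \<Rightarrow> (\<pi> z, \<pi> x XOR \<pi> z, \<pi> y XOR \<pi> z)) \<in> ?V \<times> ?D"
        by (simp add: xyz)
    qed
    show "inj_on (\<lambda>(x, y, z). (\<pi> z, \<pi> x XOR \<pi> z, \<pi> y XOR \<pi> z)) (A_hat \<pi> n)"
    proof (rule inj_onI)
      fix s t assume eq: "(case s of (x, y, z) \<Rightarrow> (\<pi> z, \<pi> x XOR \<pi> z, \<pi> y XOR \<pi> z))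
        = (case t of (x, y, z) \<Rightarrow> (\<pi> z, \<pi> x XOR \<pi> z, \<pi> y XOR \<pi> z))"
      obtain x y z x' y' z' where st: "s = (x, y, z)" "t = (x', y', z')" by (cases s, cases t) auto
      have "z = z'" "\<pi> (x XOR z) = \<pi> (x' XOR z')" "\<pi> (y XOR z) = \<pi> (y' XOR z')"
        using eq inj by (auto simp: st hom dest: injD)
      then have "x XOR z = x' XOR z" "y XOR z = y' XOR z" using inj by (auto dest: injD)
      then have "x = x'" "y = y'" by (metis xor.assoc xor.right_neutral xor_self_eq)+
      with \<open>z = z'\<close> show "s = t" by (simp add: st)
    qed
  qed (use finD in auto)
  also have "\<dots> = 2 ^ n * card ?D" by (simp only: card_cartesian_product card_V)
  also have "\<dots> \<le> 2 ^ n * 3 ^ n"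
    by (intro mult_left_mono card_disjoint_pairs_le closed card_V) auto
  also have "\<dots> = 6 ^ n" by (simp flip: power_mult_distrib)
  finally show ?thesis .
qed

lemma liminf_A_hat_block_max:
  assumes inj: "inj \<pi>" and lin: "dyadically_linear \<pi>"
    and small: "(\<lambda>n. real (block_max f n)) \<in> o(\<lambda>n. 4 ^ n / 3 ^ n)"
  shows "liminf (\<lambda>n. ereal (real (card (A_hat \<pi> n)) * real (block_max f n) / 8 ^ n)) = 0"
proof -
  have "(\<lambda>n. real (card (A_hat \<pi> n)) * real (block_max f n) / 8 ^ n) \<longlonglongrightarrow> 0"
  proof (rule tendsto_sandwich[OF _ _ tendsto_const smalloD_tendsto[OF small]])
    show "\<forall>\<^sub>F n in sequentially. real (card (A_hat \<pi> n)) * real (block_max f n) / 8 ^ n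
        \<le> real (block_max f n) / (4 ^ n / 3 ^ n)"
    proof (rule always_eventually, rule allI)
      fix n
      have "real (card (A_hat \<pi> n)) \<le> 6 ^ n"
        using of_nat_mono[OF card_A_hat_dyadically_linear_le[OF inj lin, of n], where 'a = real] by simp
      then have "real (card (A_hat \<pi> n)) * real (block_max f n) / 8 ^ n \<le> 6 ^ n * real (block_max f n) / 8 ^ n"
        by (intro divide_right_mono mult_right_mono) auto
      also have "\<dots> = (6 / 8) ^ n * real (block_max f n)"
        by (simp only: power_divide times_divide_eq_left)
      also have "\<dots> = (3 / 4) ^ n * real (block_max f n)" by simp
      finally show "real (card (A_hat \<pi> n)) * real (block_max f n) / 8 ^ n
        \<le> real (block_max f n) / (4 ^ n / 3 ^ n)" by (simp add: power_divide mult.commute)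
    qed
  qed auto
  then have "(\<lambda>n. ereal (real (card (A_hat \<pi> n)) * real (block_max f n) / 8 ^ n)) \<longlonglongrightarrow> 0"
    by (simp add: zero_ereal_def)
  then show ?thesis by (intro lim_imp_Liminf) auto
qed

theorem theorem5p14:
  fixes \<pi> \<sigma> f :: "nat \<Rightarrow> nat"
  assumes "bij \<pi>" and "bij \<sigma>"
    and "\<And>u. int (f u) = \<bar>int (\<pi> u) - int (\<sigma> u)\<bar>"
  shows
    "(liminf (\<lambda>n. ereal (real (card (A_hat \<pi> n)) * real (block_max f n) / 8 ^ n)) = 0 \<longrightarrow>
        (\<forall>p::real. 1 < p \<and> p \<noteq> 2 \<longrightarrow>
           \<not> equivalent_Lp p (\<lambda>k. trig (\<sigma> k)) (\<lambda>k t. complex_of_real (walsh k t)))) \<and>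
     (dyadically_linear \<pi> \<and> (\<lambda>n. real (block_max f n)) \<in> o(\<lambda>n. 4 ^ n / 3 ^ n) \<longrightarrow>
        liminf (\<lambda>n. ereal (real (card (A_hat \<pi> n)) * real (block_max f n) / 8 ^ n)) = 0 \<and>
        (\<forall>p::real. 1 < p \<and> p \<noteq> 2 \<longrightarrow>
           \<not> equivalent_Lp p (\<lambda>k. trig (\<sigma> k)) (\<lambda>k t. complex_of_real (walsh k t))))"
proof -
  have inj: "inj \<pi>" "inj \<sigma>" using assms(1,2) by (auto intro: bij_is_inj)
  show ?thesis
    using not_equivalent_trig_walsh[OF _ _ inj(2)] liminf_A_hat_block_max[OF inj(1)] by blast
qed

end
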